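(* Let $d\ge 1$, $N\ge3$ and $K\ge1$ be integers with $2K<N$, and let $\zeta$ be an $\mathbb{R}^d$-valued random variable such that for every $x\in\operatorname{supp}\zeta$ there exists $\gamma=\gamma(x)>0$ for which the set $B_\gamma(x)\cap\operatorname{supp}\zeta$ is regular. Then for the Jante's law process with parameters $N,K,\zeta$, $$\mathbb{P}\left(\{\mathcal{X}'(t)\to\phi \text{ for some }\phi\in\mathbb{R}^d\}\cup\{\mathcal{X}'(t)\to\infty\}\right)=1.$$
   Context: Notation: $\|\cdot\|$ is the Euclidean norm on $\mathbb{R}^d$; $B_r(x)$ is the open ball of radius $r$ centred at $x$; $\operatorname{supp}\zeta=\{x\in\mathbb{R}^d:\ \mathbb{P}(\zeta\in B_\varepsilon(x))>0\ \forall\varepsilon>0\}$. For points $x_1,\dots,x_n\in\mathbb{R}^d$ let $\mu_n(x_1,\dots,x_n)=\frac1n\sum_{i=1}^n x_i$ and $G_n(x_1,\dots,x_n)=\frac1n\sum_{i=1}^n\sum_{j=1}^{i-1}\|x_i-x_j\|^2=\sum_{i=1}^n\|x_i-\mu_n\|^2$. Regular set: a subset $A\subseteq\operatorname{supp}\zeta$ is regular with parameters $\delta_A\in(0,1)$, $\sigma_A>0$, $r_A>0$ if $\mathbb{P}(\zeta\in B_{r\delta_A}(x)\mid\zeta\in B_r(x))\ge\sigma_A$ for all $x\in A$ and all $0<r\le r_A$. $A$ is regular if it is regular with some such parameters. Core: given a configuration (finite multiset) of $N$ points, its core is a subconfiguration of $N-K$ of these points which minimizes $G_{N-K}$ among all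 subconfigurations of size $N-K$; if there are several minimizers, one of them is chosen with equal probability. Jante's law process with parameters $N,K,\zeta$: the initial configuration $\mathcal{X}(0)$ consists of $N$ distinct points of $\operatorname{supp}\zeta$ (arbitrary or random). Let $\zeta_{t;j}$, $t=1,2,\dots$, $j=1,\dots,K$, be i.i.d. with the distribution of $\zeta$, independent of the initial configuration. Given $\mathcal{X}(t)$, let $\mathcal{X}'(t)$ be its core, and set $\mathcal{X}(t+1)=\mathcal{X}'(t)\cup\{\zeta_{t+1;1},\dots,\zeta_{t+1;K}\}$ (points counted with multiplicity). We write $\mathcal{X}'(t)\to\phi\in\mathbb{R}^d$ if all the elements of $\mathcal{X}'(t)$ converge to $\phi$ as $t\to\infty$ (i.e. $\max_{x\in\mathcal{X}'(t)}\|x-\phi\|\to0$), and $\mathcal{X}'(t)\to\infty$ if $\min\{\|x\|:\ x\in\mathcal{X}'(t)\}\to\infty$ as $t\to\infty$. *)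

theory Defs
  imports "HOL-Probability.Probability"
begin

section \<open>Support and regular sets of a law\<close>

text \<open>
  All notions attached to a random variable \<open>\<zeta>\<close> depend only on its law, and they are stated for a
  Borel measure \<open>\<mu>\<close> that plays the role of this law.
\<close>

definition supp :: "'a::euclidean_space measure \<Rightarrow> 'a set" where
  "supp \<mu> = {x. \<forall>\<epsilon>>0. measure \<mu> (ball x \<epsilon>) > 0}"

definition regular_with :: "'a::euclidean_space measure \<Rightarrow> 'a set \<Rightarrow> real \<Rightarrow> real \<Rightarrow> real \<Rightarrow> bool" where
  "regular_with \<mu> A \<delta> \<sigma> r\<^sub>0 \<longleftrightarrow>
     A \<subseteq> supp \<mu> \<and> 0 < \<delta> \<and> \<delta> < 1 \<and> 0 < \<sigma> \<and> 0 < r\<^sub>0 \<and>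
     (\<forall>x\<in>A. \<forall>r. 0 < r \<and> r \<le> r\<^sub>0 \<longrightarrow> \<P>(z in \<mu>. z \<in> ball x (r * \<delta>) \<bar> z \<in> ball x r) \<ge> \<sigma>)"

definition regular :: "'a::euclidean_space measure \<Rightarrow> 'a set \<Rightarrow> bool" where
  "regular \<mu> A \<longleftrightarrow> (\<exists>\<delta> \<sigma> r\<^sub>0. regular_with \<mu> A \<delta> \<sigma> r\<^sub>0)"


section \<open>Configurations and cores\<close>

definition centre :: "'a::euclidean_space multiset \<Rightarrow> 'a" where
  "centre C = (1 / real (size C)) *\<^sub>R (\<Sum>x\<in>#C. x)"

definition G :: "'a::euclidean_space multiset \<Rightarrow> real" where
  "G C = (\<Sum>x\<in>#C. (norm (x - centre C))\<^sup>2)"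

text \<open>The set of all admissible cores; subconfigurations are taken as submultisets.\<close>

definition cores :: "nat \<Rightarrow> 'a::euclidean_space multiset \<Rightarrow> 'a multiset set" where
  "cores K C = {D. is_arg_min G (\<lambda>D. D \<subseteq># C \<and> size D = size C - K) D}"

text \<open>
  The usual \<open>\<sigma>\<close>-algebra on configurations: it is generated by the maps that count the points in
  a Borel set.
\<close>

definition config_algebra :: "'a::euclidean_space multiset measure" where
  "config_algebra = sigma UNIV {{C. size (filter_mset (\<lambda>x. x \<in> B) C) = k} | B k. B \<in> sets borel}"

text \<open>\<open>G\<close> in terms of pairwise distances.\<close>

lemma G_mset:
  fixes xs :: "'a::euclidean_space list"
  defines "n \<equiv> length xs"
  shows "G (mset xs) = (1 / real n) * (\<Sum>i<n. \<Sum>j<i. (norm (xs ! i - xs ! j))\<^sup>2)"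
proof (cases "n = 0")
  case True
  then show ?thesis by (simp add: G_def n_def)
next
  case False
  define x where "x i = xs ! i" for i
  define S where "S = (\<Sum>i<n. x i)"
  define Q where "Q = (\<Sum>i<n. x i \<bullet> x i)"
  have sum_xs: "sum_list (map f xs) = (\<Sum>i<n. f (x i))" for f :: "'a \<Rightarrow> 'b::comm_monoid_add"
    by (simp add: sum_list_sum_nth n_def x_def atLeast0LessThan)
  have c: "centre (mset xs) = (1 / real n) *\<^sub>R S"
    using sum_xs[of "\<lambda>x. x"] by (simp add: centre_def sum_mset_sum_list S_def n_def)
  have "G (mset xs) = (\<Sum>i<n. (norm (x i - (1 / real n) *\<^sub>R S))\<^sup>2)"
    unfolding G_def c using sum_xs[of "\<lambda>x. (norm (x - (1 / real n) *\<^sub>R S))\<^sup>2"]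
    by (simp flip: mset_map add: sum_mset_sum_list)
  also have "\<dots> = (\<Sum>i<n. x i \<bullet> x i - (2 / real n) * (x i \<bullet> S) + (S \<bullet> S) / (real n)\<^sup>2)"
    unfolding power2_norm_eq_inner
    by (intro sum.cong)
      (auto simp: inner_diff_left inner_diff_right inner_commute power2_eq_square algebra_simps)
  also have "\<dots> = Q - (2 / real n) * (S \<bullet> S) + real n * ((S \<bullet> S) / (real n)\<^sup>2)"
    by (simp add: sum.distrib sum_subtractf Q_def S_def inner_sum_left sum_distrib_left)
  also have "\<dots> = Q - (S \<bullet> S) / real n"
    using False by (simp add: field_simps power2_eq_square)
  finally have G: "G (mset xs) = Q - (S \<bullet> S) / real n" .
  have SS: "(\<Sum>i<n. \<Sum>j<n. x i \<bullet> x j) = S \<bullet> S"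
    unfolding S_def inner_sum_left inner_sum_right by (rule sum.swap)
  have pair: "(\<Sum>i<m. \<Sum>j<m. (norm (x i - x j))\<^sup>2) = 2 * (\<Sum>i<m. \<Sum>j<i. (norm (x i - x j))\<^sup>2)" for m
    by (induction m) (simp_all add: sum.distrib norm_minus_commute)
  have "(\<Sum>i<n. \<Sum>j<n. (norm (x i - x j))\<^sup>2)
      = (\<Sum>i<n. \<Sum>j<n. x i \<bullet> x i + x j \<bullet> x j - 2 * (x i \<bullet> x j))"
    unfolding power2_norm_eq_inner
    by (intro sum.cong) (auto simp: inner_diff_left inner_diff_right inner_commute)
  also have "\<dots> = 2 * real n * Q - 2 * (S \<bullet> S)"
    by (simp add: sum.distrib sum_subtractf Q_def sum_distrib_left[symmetric] SS)
  finally have "(\<Sum>i<n. \<Sum>j<i. (norm (x i - x j))\<^sup>2) = real n * Q - S \<bullet> S"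
    using pair[of n] by simp
  then show ?thesis
    using False unfolding G x_def by (simp add: field_simps)
qed


section \<open>The process\<close>

text \<open>
  \<open>X t\<close> is the configuration and \<open>Y t\<close> its core at time \<open>t\<close>; the points \<open>Z t j\<close> with \<open>t \<ge> 1\<close> and
  \<open>j \<in> {1..K}\<close> are the draws added at time \<open>t\<close>.  The \<open>\<sigma>\<close>-algebra \<open>past M K X Y Z t u\<close> is generated by
  the initial configuration, the draws up to time \<open>t\<close> and the cores chosen before time \<open>u\<close>.
\<close>

definition past :: "'w measure \<Rightarrow> nat \<Rightarrow> (nat \<Rightarrow> 'w \<Rightarrow> 'a::euclidean_space multiset) \<Rightarrow>
    (nat \<Rightarrow> 'w \<Rightarrow> 'a multiset) \<Rightarrow> (nat \<Rightarrow> nat \<Rightarrow> 'w \<Rightarrow> 'a) \<Rightarrow> nat \<Rightarrow> nat \<Rightarrow> 'w measure" where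
  "past M K X Y Z t u = sigma (space M)
     ({X 0 -` A \<inter> space M | A. A \<in> sets config_algebra} \<union>
      {Z s j -` B \<inter> space M | s j B. s \<in> {1..t} \<and> j \<in> {1..K} \<and> B \<in> sets borel} \<union>
      {Y s -` A \<inter> space M | s A. s < u \<and> A \<in> sets config_algebra})"

definition future :: "'w measure \<Rightarrow> nat \<Rightarrow> (nat \<Rightarrow> nat \<Rightarrow> 'w \<Rightarrow> 'a::euclidean_space) \<Rightarrow> nat \<Rightarrow> 'w measure"
  where
  "future M K Z t = sigma (space M)
     {Z s j -` B \<inter> space M | s j B. s > t \<and> j \<in> {1..K} \<and> B \<in> sets borel}"

text \<open>
  The assumption \<open>future_indep\<close> says that the draws are independent of the initial configuration
  (case \<open>t = 0\<close>) and that the randomness used to break ties does not anticipate later draws.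
  The assumption \<open>tie_break\<close> says that, given everything that happened before the core is chosen
  at time \<open>t\<close>, the core is uniformly distributed on the set of minimizers.
\<close>

locale jante_process = prob_space M
  for M :: "'w measure"
  and N K :: nat
  and \<mu> :: "'a::euclidean_space measure"
  and X Y :: "nat \<Rightarrow> 'w \<Rightarrow> 'a multiset"
  and Z :: "nat \<Rightarrow> nat \<Rightarrow> 'w \<Rightarrow> 'a" +
  assumes X0_measurable: "X 0 \<in> measurable M config_algebra"
    and Y_measurable: "\<And>t. Y t \<in> measurable M config_algebra"
    and X0_size: "\<And>\<omega>. \<omega> \<in> space M \<Longrightarrow> size (X 0 \<omega>) = N"
    and X0_distinct: "AE \<omega> in M. card (set_mset (X 0 \<omega>)) = N"
    and X0_supp: "AE \<omega> in M. set_mset (X 0 \<omega>) \<subseteq> supp \<mu>"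
    and draws_indep: "indep_vars (\<lambda>_. borel) (\<lambda>(t, j). Z t j) ({1..} \<times> {1..K})"
    and draws_law: "\<And>t j. t \<ge> 1 \<Longrightarrow> j \<in> {1..K} \<Longrightarrow> distr M borel (Z t j) = \<mu>"
    and future_indep: "\<And>t. indep_set (sets (past M K X Y Z t (Suc t))) (sets (future M K Z t))"
    and core: "\<And>t \<omega>. \<omega> \<in> space M \<Longrightarrow> Y t \<omega> \<in> cores K (X t \<omega>)"
    and tie_break: "\<And>t B. B \<in> sets config_algebra \<Longrightarrow>
      AE \<omega> in M. real_cond_exp M (past M K X Y Z t t) (indicator (Y t -` B \<inter> space M)) \<omega> =
        measure_pmf.prob (pmf_of_set (cores K (X t \<omega>))) B"
    and step: "\<And>t \<omega>. \<omega> \<in> space M \<Longrightarrow>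
      X (Suc t) \<omega> = Y t \<omega> + image_mset (\<lambda>j. Z (Suc t) j \<omega>) (mset_set {1..K})"


section \<open>Convergence of configurations\<close>

definition config_tendsto :: "(nat \<Rightarrow> 'a::euclidean_space multiset) \<Rightarrow> 'a \<Rightarrow> bool" where
  "config_tendsto C \<phi> \<longleftrightarrow> (\<lambda>t. MAX x\<in>set_mset (C t). norm (x - \<phi>)) \<longlonglongrightarrow> 0"

definition config_tendsto_infinity :: "(nat \<Rightarrow> 'a::euclidean_space multiset) \<Rightarrow> bool" where
  "config_tendsto_infinity C \<longleftrightarrow> filterlim (\<lambda>t. MIN x\<in>set_mset (C t). norm x) at_top sequentially"

end

theory Submission
  imports Defs
begin

text \<open>
  Write \<open>n = N - K\<close> for the number of points of a core \<open>C\<close>, \<open>m\<close> for its centre and \<open>s = sqrt (G C)\<close> for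
  its spread; all points of \<open>C\<close> lie within \<open>s\<close> of \<open>m\<close>.  The old core is always a candidate for the new
  one, so \<open>s\<close> never increases.  Two balls around \<open>m\<close> control the dynamics.

  \<^item> A draw in the ball of radius \<open>s / sqrt (n - 1)\<close> multiplies \<open>s\<close> by a factor at most
    \<open>sqrt (1 - 1/n\<^sup>2) < 1\<close>: averaged over all points \<open>y\<close> of the core, exchanging \<open>y\<close> for such a draw
    decreases \<open>G\<close> (\<open>G_replace_drop\<close>, \<open>core_drop\<close>).
  \<^item> The core can change only if some draw lands in the ball of radius \<open>3 s\<close>, because consecutive cores
    share a point (this is where \<open>2 K < N\<close> enters); and then \<open>m\<close> moves by at most \<open>2 s\<close>
    (\<open>core_change\<close>, \<open>core_centre_move\<close>).

  The first fact gives an energy estimate.  The total decrease of a nonincreasing nonnegative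
  quantity is bounded, and the draws at time \<open>t + 1\<close> are independent of the core at time \<open>t\<close>, so
  almost surely the sum over \<open>t\<close> of \<open>s\<close> times the \<open>\<mu>\<close>-measure of the small ball is finite; large values
  of \<open>s\<close> are cut off in the expectations, since the initial spread need not be integrable
  (\<open>AE_shrink_ball_summable\<close>).  Wherever the measure of the large ball is at most \<open>\<kappa>\<close> times that of
  the small one, the same bound, multiplied by \<open>\<kappa> K\<close>, applies to the sum of \<open>s\<close> over the times at
  which a draw lands in the large ball; hence this sum is almost surely finite for every \<open>\<kappa>\<close>
  (\<open>AE_reach_ball_summable\<close>).

  The rest is deterministic (\<open>core_sequence_converges\<close>).  If the cores do not tend to infinity, their
  points that lie close to the centre accumulate at some \<open>\<phi>\<close> in the support.  Were \<open>s\<close> bounded away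
  from \<open>0\<close>, the small balls would infinitely often contain a fixed ball around \<open>\<phi>\<close>,
  contradicting the energy estimate; so \<open>s\<close> tends to \<open>0\<close>.  Regularity near \<open>\<phi>\<close>, iterated a
  fixed number of times, bounds the ratio of the measures of the two balls as long as the core stays
  close to \<open>\<phi>\<close>.  There the displacements of the centre are thus summable, and a sequence that keeps
  returning to \<open>\<phi>\<close> and whose steps near \<open>\<phi>\<close> are summable converges to \<open>\<phi>\<close>.
\<close>


section \<open>Geometry and measurability of the spread\<close>

lemma count_in_measurable:
  fixes B :: "'a::euclidean_space set"
  assumes "B \<in> sets borel"
  shows "(\<lambda>C. size (filter_mset (\<lambda>x. x \<in> B) C)) \<in> measurable config_algebra (count_space UNIV)"
proof -
  have "{C. size (filter_mset (\<lambda>x. x \<in> B) C) = k} \<in> sets config_algebra" for k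
    using assms unfolding config_algebra_def by (auto intro!: sigma_sets.Basic)
  then show ?thesis
    by (auto simp: measurable_count_space_eq2_countable vimage_def config_algebra_def)
qed

text \<open>
  The \<open>\<sigma>\<close>-algebra on configurations only knows the counts, which are the sums of indicator functions.
  A sum of \<open>f\<close> over a configuration is a limit of sums of simple functions, and those are finite
  linear combinations of counts.
\<close>

lemma sum_mset_measurable:
  fixes f :: "'a::euclidean_space \<Rightarrow> 'b::euclidean_space"
  assumes f: "f \<in> borel_measurable borel"
  shows "(\<lambda>C. \<Sum>x\<in>#C. f x) \<in> borel_measurable config_algebra"
proof -
  obtain F where F: "\<And>i. simple_function borel (F i)" and lim: "\<And>x. (\<lambda>i. F i x) \<longlonglongrightarrow> f x"
    using borel_measurable_implies_sequence_metric[OF f, of 0] by auto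
  have fin: "finite (range (F i))" for i
    using simple_functionD(1)[OF F[of i]] by simp
  have eq: "(\<Sum>x\<in>#C. F i x) = (\<Sum>v\<in>range (F i). real (size {#x \<in># C. x \<in> F i -` {v}#}) *\<^sub>R v)" for i C
  proof (induction C)
    case empty
    then show ?case by simp
  next
    case (add a C)
    have "(\<Sum>v\<in>range (F i). real (size {#x \<in># add_mset a C. x \<in> F i -` {v}#}) *\<^sub>R v) =
        (\<Sum>v\<in>range (F i). (if F i a = v then v else 0) + real (size {#x \<in># C. x \<in> F i -` {v}#}) *\<^sub>R v)"
      by (intro sum.cong) (auto simp: scaleR_add_left)
    also have "\<dots> = F i a + (\<Sum>x\<in>#C. F i x)"
      by (simp add: sum.distrib fin add)
    finally show ?case by simp
  qed
  have "F i -` {v} \<in> sets borel" for i v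
    using simple_functionD(2)[OF F[of i], of "{v}"] by simp
  then have [measurable]: "(\<lambda>C. \<Sum>x\<in>#C. F i x) \<in> borel_measurable config_algebra" for i
    unfolding eq by (intro borel_measurable_sum borel_measurable_scaleR borel_measurable_const
      measurable_compose[OF count_in_measurable]) auto
  have "(\<lambda>i. \<Sum>x\<in>#C. F i x) \<longlonglongrightarrow> (\<Sum>x\<in>#C. f x)" for C
    by (induction C) (auto intro!: tendsto_add lim)
  then show ?thesis
    by (rule borel_measurable_LIMSEQ_metric[rotated]) measurable
qed

lemma size_measurable: "(\<lambda>C::'a::euclidean_space multiset. real (size C)) \<in> borel_measurable config_algebra"
  using sum_mset_measurable[of "\<lambda>_::'a. 1::real"] by simp

lemma centre_measurable: "centre \<in> borel_measurable (config_algebra :: 'a::euclidean_space multiset measure)"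
proof -
  note [measurable] = size_measurable
  have [measurable]: "(\<lambda>C::'a multiset. \<Sum>x\<in>#C. x) \<in> borel_measurable config_algebra"
    using sum_mset_measurable[of "\<lambda>x::'a. x"] by simp
  show ?thesis unfolding centre_def[abs_def] by measurable
qed

lemma sum_sq_dist:
  fixes C :: "'a::euclidean_space multiset"
  shows "(\<Sum>x\<in>#C. (norm (x - p))\<^sup>2) =
    (\<Sum>x\<in>#C. (norm x)\<^sup>2) - 2 * ((\<Sum>x\<in>#C. x) \<bullet> p) + size C * (norm p)\<^sup>2"
  by (induction C) (auto simp: algebra_simps power2_norm_eq_inner inner_diff_left inner_diff_right inner_commute)

lemma sum_mset_eq_centre: "(\<Sum>x\<in>#C. x) = real (size C) *\<^sub>R centre C"
  by (cases "C = {#}") (auto simp: centre_def)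

text \<open>
  The parallel axis theorem: it expresses \<open>G\<close> through sums over the configuration, and it compares
  \<open>G\<close> with the second moment about any other point.
\<close>

lemma sum_sq_dist_eq_G:
  fixes C :: "'a::euclidean_space multiset"
  shows "(\<Sum>x\<in>#C. (norm (x - p))\<^sup>2) = G C + size C * (norm (centre C - p))\<^sup>2"
  unfolding G_def sum_sq_dist sum_mset_eq_centre
  by (simp add: algebra_simps power2_norm_eq_inner inner_diff_left inner_diff_right inner_commute)

lemma G_measurable: "G \<in> borel_measurable (config_algebra :: 'a::euclidean_space multiset measure)"
proof -
  note [measurable] = size_measurable centre_measurable
  have [measurable]: "(\<lambda>C::'a multiset. \<Sum>x\<in>#C. (norm x)\<^sup>2) \<in> borel_measurable config_algebra"
    by (rule sum_mset_measurable) measurable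
  have "(\<lambda>C::'a multiset. (\<Sum>x\<in>#C. (norm x)\<^sup>2) - real (size C) * (norm (centre C))\<^sup>2)
      \<in> borel_measurable config_algebra"
    by measurable
  also have "(\<lambda>C::'a multiset. (\<Sum>x\<in>#C. (norm x)\<^sup>2) - real (size C) * (norm (centre C))\<^sup>2) = G"
    using sum_sq_dist_eq_G[where p="0::'a"] by (auto simp: fun_eq_iff)
  finally show ?thesis .
qed

lemma sum_sq_norm_nonneg: "(\<Sum>x\<in>#C. (norm (x - p))\<^sup>2) \<ge> 0"
  by (induction C) auto

lemma G_nonneg: "G C \<ge> 0"
  unfolding G_def by (rule sum_sq_norm_nonneg)

lemma norm_centre_le:
  assumes "x \<in># C"
  shows "norm (x - centre C) \<le> sqrt (G C)"
proof -
  obtain B where B: "C = add_mset x B" using assms by (metis insert_DiffM)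
  have "G C = (norm (x - centre C))\<^sup>2 + (\<Sum>y\<in>#B. (norm (y - centre C))\<^sup>2)"
    unfolding G_def by (simp add: B)
  then show ?thesis
    using sum_sq_norm_nonneg[where C=B and p="centre C"] by (simp add: real_le_rsqrt)
qed

lemma exists_le_average:
  fixes f :: "'a \<Rightarrow> real" and a :: real
  assumes "C \<noteq> {#}" "(\<Sum>x\<in>#C. f x) \<le> size C * a"
  shows "\<exists>x\<in>#C. f x \<le> a"
proof (rule ccontr)
  assume "\<not> ?thesis"
  then have less: "\<forall>x\<in>#C. a < f x" by auto
  have "C \<noteq> {#} \<Longrightarrow> \<forall>x\<in>#C. a < f x \<Longrightarrow> size C * a < (\<Sum>x\<in>#C. f x)"
  proof (induction C)
    case (add x C)
    then show ?case by (cases "C = {#}") (auto simp: algebra_simps)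
  qed simp
  with assms less show False by simp
qed

lemma exists_point_near_centre:
  assumes "C \<noteq> {#}"
  shows "\<exists>x\<in>#C. norm (x - centre C) \<le> sqrt (G C) / sqrt (size C)"
proof -
  have "\<exists>x\<in>#C. (norm (x - centre C))\<^sup>2 \<le> G C / size C"
    by (rule exists_le_average[OF assms]) (use assms in \<open>auto simp: G_def\<close>)
  then obtain x where "x \<in># C" "norm (x - centre C) \<le> sqrt (G C / size C)"
    by (auto dest: real_le_rsqrt)
  then show ?thesis by (auto simp: real_sqrt_divide)
qed

text \<open>
  Exchanging \<open>y\<close> for \<open>z\<close> moves the centre by \<open>(z - y) / n\<close>; the parallel axis theorem for the new
  configuration, about the old centre, then gives the new value of \<open>G\<close>.
\<close>

lemma G_replace:
  fixes C :: "'a::euclidean_space multiset"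
  assumes "y \<in># C"
  shows "G (C - {#y#} + {#z#}) =
    G C - (norm (y - centre C))\<^sup>2 + (norm (z - centre C))\<^sup>2 - (norm (z - y))\<^sup>2 / size C"
proof -
  obtain B where B: "C = add_mset y B" using assms by (metis insert_DiffM)
  let ?D = "add_mset z B" and ?n = "real (size C)"
  have n: "?n > 0" by (simp add: B)
  have "?n *\<^sub>R centre ?D = (\<Sum>x\<in>#?D. x)" by (simp only: sum_mset_eq_centre B size_add_mset)
  also have "\<dots> = (\<Sum>x\<in>#C. x) + (z - y)" by (simp add: B)
  also have "\<dots> = ?n *\<^sub>R centre C + (z - y)" by (simp only: sum_mset_eq_centre)
  finally have "?n *\<^sub>R centre ?D = ?n *\<^sub>R centre C + (z - y)" .
  then have "?n *\<^sub>R (centre ?D - centre C) = z - y" by (simp add: algebra_simps)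
  from arg_cong[OF this, of norm] have "?n * norm (centre ?D - centre C) = norm (z - y)"
    by simp
  from arg_cong[OF this, of "\<lambda>r. r\<^sup>2"]
  have "?n\<^sup>2 * (norm (centre ?D - centre C))\<^sup>2 = (norm (z - y))\<^sup>2"
    by (simp add: power_mult_distrib)
  then have *: "?n * (norm (centre ?D - centre C))\<^sup>2 = (norm (z - y))\<^sup>2 / ?n"
    using n by (simp add: eq_divide_eq power2_eq_square mult.assoc mult.commute)
  have "G ?D + ?n * (norm (centre ?D - centre C))\<^sup>2 = (\<Sum>x\<in>#?D. (norm (x - centre C))\<^sup>2)"
    unfolding sum_sq_dist_eq_G by (simp add: B)
  also have "\<dots> = G C - (norm (y - centre C))\<^sup>2 + (norm (z - centre C))\<^sup>2"
    unfolding G_def by (simp add: B)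
  finally show ?thesis using * by (simp add: B)
qed

text \<open>
  The best point to remove need not be identified: summing the formula of \<open>G_replace\<close> over all points
  \<open>y\<close> shows that a uniformly chosen exchange has \<open>G\<close>-value at most the stated bound on average.
  The hypothesis describes a ball around the centre whose radius exceeds \<open>sqrt (G C / n)\<close>, the
  root mean square distance from the centre; unless all points coincide, it therefore contains a
  neighbourhood of a point of \<open>C\<close>, and draws from a law charging that neighbourhood do hit it.
\<close>

lemma G_replace_drop:
  fixes C :: "'a::euclidean_space multiset"
  assumes "C \<noteq> {#}" and z: "(real (size C) - 1) * (norm (z - centre C))\<^sup>2 \<le> G C"
  shows "\<exists>y\<in>#C. G (C - {#y#} + {#z#}) \<le> (1 - 1 / (real (size C))\<^sup>2) * G C"
proof -
  let ?n = "real (size C)" and ?w = "(norm (z - centre C))\<^sup>2"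
  have n: "?n > 0" using assms(1) by (simp add: nonempty_has_size)
  have "(\<Sum>y\<in>#C. G (C - {#y#} + {#z#})) =
      (\<Sum>y\<in>#C. (G C + ?w) - (norm (y - centre C))\<^sup>2 - (norm (y - z))\<^sup>2 / ?n)"
    by (rule arg_cong[of _ _ sum_mset], rule image_mset_cong, subst G_replace)
       (simp_all add: norm_minus_commute[of z])
  also have "\<dots> = ?n * (G C + ?w) - (\<Sum>y\<in>#C. (norm (y - centre C))\<^sup>2) - (\<Sum>y\<in>#C. (norm (y - z))\<^sup>2) / ?n"
  proof -
    have "(\<Sum>y\<in>#D. a - f y - g y / b) = size D * a - (\<Sum>y\<in>#D. f y) - (\<Sum>y\<in>#D. g y) / b"
      for D :: "'a multiset" and a b :: real and f g
      by (induction D) (simp_all add: distrib_right add_divide_distrib)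
    then show ?thesis .
  qed
  also have "\<dots> = ?n * (G C + ?w) - G C - (G C + ?n * ?w) / ?n"
    by (simp only: sum_sq_dist_eq_G G_def[symmetric] norm_minus_commute[of z]) simp
  also have "\<dots> = ?n * ((1 - 1 / ?n\<^sup>2) * G C) + ((?n - 1) * ?w - G C)"
  proof -
    have "(G C + ?n * ?w) / ?n = G C / ?n + ?w"
      using assms(1) by (simp add: add_divide_distrib)
    moreover have "?n * ((1 - 1 / ?n\<^sup>2) * G C) = ?n * G C - G C / ?n"
      using n by (simp add: left_diff_distrib right_diff_distrib power2_eq_square)
    ultimately show ?thesis by (simp add: distrib_left left_diff_distrib)
  qed
  also have "\<dots> \<le> ?n * ((1 - 1 / ?n\<^sup>2) * G C)" using z by simp
  finally show ?thesis by (rule exists_le_average[OF assms(1)])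
qed


section \<open>One step of the core\<close>

lemma core_minimal:
  assumes "D \<in> cores K C" "E \<subseteq># C" "size E = size C - K"
  shows "G D \<le> G E"
  using assms by (auto simp: cores_def is_arg_min_linorder)

lemma core_subset: "D \<in> cores K C \<Longrightarrow> D \<subseteq># C"
  and core_size: "D \<in> cores K C \<Longrightarrow> size D = size C - K"
  by (auto simp: cores_def is_arg_min_def)

lemma core_G_decreases:
  assumes "D \<in> cores K (C + W)" "size W = K"
  shows "sqrt (G D) \<le> sqrt (G C)"
  using core_minimal[OF assms(1), of C] assms(2) by simp

text \<open>
  The configuration found in \<open>G_replace_drop\<close> is a candidate for the new core.
\<close>

lemma core_drop:
  fixes C :: "'a::euclidean_space multiset"
  assumes D: "D \<in> cores K (C + W)" and W: "size W = K" and C: "size C \<ge> 2"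
    and z: "z \<in># W" "norm (z - centre C) \<le> sqrt (G C) / sqrt (real (size C) - 1)"
  shows "sqrt (G D) \<le> sqrt (1 - 1 / (real (size C))\<^sup>2) * sqrt (G C)"
proof -
  let ?n = "real (size C)"
  have "(norm (z - centre C))\<^sup>2 \<le> (sqrt (G C) / sqrt (?n - 1))\<^sup>2"
    by (rule power_mono[OF z(2)]) simp
  also have "\<dots> = G C / (?n - 1)"
    using C G_nonneg[of C] by (simp add: power_divide)
  finally have "(?n - 1) * (norm (z - centre C))\<^sup>2 \<le> G C"
    using C by (simp add: field_simps)
  moreover have "C \<noteq> {#}" using C by auto
  ultimately obtain y where y: "y \<in># C" "G (C - {#y#} + {#z#}) \<le> (1 - 1 / ?n\<^sup>2) * G C"
    using G_replace_drop by blast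
  have "C - {#y#} + {#z#} \<subseteq># C + W"
    using z(1) by (intro subset_mset.add_mono) auto
  moreover have "size (C - {#y#} + {#z#}) = size (C + W) - K"
    using y(1) W C by (simp add: size_Diff_singleton)
  ultimately have "G D \<le> G (C - {#y#} + {#z#})"
    by (rule core_minimal[OF D])
  also note y(2)
  finally show ?thesis by (simp flip: real_sqrt_mult)
qed

text \<open>
  The \<open>K\<close> new points alone cannot fill a core of more than \<open>K\<close> points.
\<close>

lemma core_shares_point:
  assumes D: "D \<in> cores K (C + W)" and W: "size W = K" and C: "K < size C"
  shows "\<exists>x. x \<in># C \<and> x \<in># D"
proof (rule ccontr)
  assume no: "\<not> ?thesis"
  have "D \<subseteq># W"
  proof (rule mset_subset_eqI)
    fix x
    show "count D x \<le> count W x"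
      using no mset_subset_eq_count[OF core_subset[OF D], of x]
      by (cases "x \<in># C") (simp, metis count_eq_zero_iff le0, simp add: not_in_iff)
  qed
  then have "size D \<le> K" using W size_mset_mono by auto
  then show False using core_size[OF D] W C by simp
qed

text \<open>
  Every point of the new core is within \<open>2 * sqrt (G C)\<close> of a point \<open>x\<close> shared with the old core, by
  way of the new centre, and \<open>x\<close> is within \<open>sqrt (G C)\<close> of the old centre.  If no draw is that close,
  the new core consists of old points only and equals the old core.
\<close>

lemma core_change:
  fixes C :: "'a::euclidean_space multiset"
  assumes D: "D \<in> cores K (C + W)" and W: "size W = K" and C: "K < size C"
    and "D \<noteq> C"
  shows "\<exists>z\<in>#W. norm (z - centre C) \<le> 3 * sqrt (G C)"
proof (rule ccontr)
  assume far: "\<not> ?thesis"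
  obtain x where x: "x \<in># C" "x \<in># D" using core_shares_point[OF D W C] by blast
  have "norm (z - centre C) \<le> 3 * sqrt (G C)" if "z \<in># D" for z
  proof -
    have "norm (z - centre C) \<le>
        norm (z - centre D) + norm (x - centre D) + norm (x - centre C)"
      by norm
    also have "\<dots> \<le> 3 * sqrt (G C)"
      using norm_centre_le[OF that] norm_centre_le[OF x(2)] norm_centre_le[OF x(1)]
        core_G_decreases[OF D W] by linarith
    finally show ?thesis .
  qed
  with far have "z \<notin># W" if "z \<in># D" for z using that by blast
  then have "D \<subseteq># C"
    using mset_subset_eq_count[OF core_subset[OF D]]
    by (intro mset_subset_eqI) (metis add.right_neutral count_eq_zero_iff count_union le0)
  moreover have "size D = size C" using core_size[OF D] W by simp
  ultimately show False
    using \<open>D \<noteq> C\<close> mset_subset_size by (metis nat_neq_iff subset_mset.le_neq_trans)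
qed

lemma core_centre_move:
  fixes C :: "'a::euclidean_space multiset"
  assumes D: "D \<in> cores K (C + W)" and W: "size W = K" and C: "K < size C"
  shows "dist (centre D) (centre C) \<le> 2 * sqrt (G C)"
proof -
  obtain x where x: "x \<in># C" "x \<in># D" using core_shares_point[OF D W C] by blast
  have "dist (centre D) (centre C) \<le> norm (x - centre D) + norm (x - centre C)"
    unfolding dist_norm by norm
  also have "\<dots> \<le> 2 * sqrt (G C)"
    using norm_centre_le[OF x(2)] norm_centre_le[OF x(1)] core_G_decreases[OF D W] by linarith
  finally show ?thesis .
qed


section \<open>Support and regularity\<close>

lemma closed_supp:
  fixes \<mu> :: "'a::euclidean_space measure"
  assumes "finite_measure \<mu>" "sets \<mu> = sets borel"
  shows "closed (supp \<mu>)"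
  unfolding closed_sequential_limits
proof safe
  fix f :: "nat \<Rightarrow> 'a" and l assume f: "\<forall>n. f n \<in> supp \<mu>" and l: "f \<longlonglongrightarrow> l"
  interpret finite_measure \<mu> by fact
  show "l \<in> supp \<mu>"
    unfolding supp_def
  proof safe
    fix e :: real assume "e > 0"
    then obtain n where n: "dist (f n) l < e / 2"
      using l by (meson half_gt_zero lim_sequentially order_refl)
    have "ball (f n) (e / 2) \<subseteq> ball l e"
    proof
      fix z assume "z \<in> ball (f n) (e / 2)"
      with n show "z \<in> ball l e"
        using dist_triangle[of l z "f n"] by (simp add: dist_commute)
    qed
    then have "measure \<mu> (ball (f n) (e/2)) \<le> measure \<mu> (ball l e)"
      by (intro finite_measure_mono) (auto simp: assms)
    moreover have "measure \<mu> (ball (f n) (e/2)) > 0"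
      using f \<open>e > 0\<close> by (simp add: supp_def)
    ultimately show "0 < measure \<mu> (ball l e)" by simp
  qed
qed

text \<open>
  Regularity compares two fixed scales; iteration allows an arbitrarily small ratio of radii at the
  price of a smaller constant.
\<close>

lemma regular_iterate:
  fixes \<mu> :: "'a::euclidean_space measure"
  assumes \<mu>: "finite_measure \<mu>" "sets \<mu> = sets borel"
    and reg: "regular_with \<mu> A \<delta> \<sigma> r\<^sub>0" and x: "x \<in> A" and r: "0 < r" "r \<le> r\<^sub>0"
  shows "\<sigma> ^ k * measure \<mu> (ball x r) \<le> measure \<mu> (ball x (r * \<delta> ^ k))"
proof (induction k)
  case (Suc k)
  interpret finite_measure \<mu> by fact
  have par: "0 < \<delta>" "\<delta> < 1" "0 < \<sigma>" and sup: "x \<in> supp \<mu>"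
    using reg x by (auto simp: regular_with_def)
  let ?r = "r * \<delta> ^ k"
  have "?r \<le> r" using par r power_le_one[of \<delta> k] by (intro mult_left_le) auto
  then have r': "0 < ?r" "?r \<le> r\<^sub>0" using par r by (simp_all add: order_trans[of _ r])
  have "\<sigma> \<le> \<P>(z in \<mu>. z \<in> ball x (?r * \<delta>) \<bar> z \<in> ball x ?r)"
    using reg x r' by (auto simp: regular_with_def)
  also have "\<dots> = measure \<mu> {z \<in> space \<mu>. z \<in> ball x (?r * \<delta>) \<and> z \<in> ball x ?r} / measure \<mu> (ball x ?r)"
    using sets_eq_imp_space_eq[OF \<mu>(2)] by (simp add: cond_prob_def ball_def)
  also have "\<dots> \<le> measure \<mu> (ball x (?r * \<delta>)) / measure \<mu> (ball x ?r)"
    by (intro divide_right_mono finite_measure_mono) (auto simp: \<mu>)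
  finally have "\<sigma> * measure \<mu> (ball x ?r) \<le> measure \<mu> (ball x (?r * \<delta>))"
    using sup r' by (auto simp: supp_def pos_le_divide_eq)
  moreover have "\<sigma> * (\<sigma> ^ k * measure \<mu> (ball x r)) \<le> \<sigma> * measure \<mu> (ball x ?r)"
    using Suc par by simp
  ultimately show ?case by (simp add: algebra_simps)
qed simp

text \<open>
  The complement of the support is a union of null balls, and countably many of them cover it.
\<close>

lemma supp_full:
  fixes \<mu> :: "'a::euclidean_space measure"
  assumes \<mu>: "finite_measure \<mu>" "sets \<mu> = sets borel"
  shows "AE z in \<mu>. z \<in> supp \<mu>"
proof -
  interpret finite_measure \<mu> by fact
  let ?F = "{ball x \<epsilon> | x \<epsilon>. measure \<mu> (ball x \<epsilon>) = 0}"
  obtain F' where F': "F' \<subseteq> ?F" "countable F'" "\<Union>F' = \<Union>?F"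
    using Lindelof[of ?F] by blast
  have "S \<in> null_sets \<mu>" if "S \<in> F'" for S
    using that F'(1) by (auto simp: null_sets_def \<mu> emeasure_eq_measure)
  then have "(\<Union>S\<in>F'. S) \<in> null_sets \<mu>"
    using F'(2) by (intro null_sets_UN') auto
  moreover have "z \<in> \<Union>F'" if z: "z \<notin> supp \<mu>" for z
  proof -
    obtain e where "e > 0" "measure \<mu> (ball z e) = 0"
      using z by (auto simp: supp_def zero_less_measure_iff not_less measure_le_0_iff)
    then have "ball z e \<in> ?F" "z \<in> ball z e" by auto
    then show ?thesis unfolding F'(3) by blast
  qed
  ultimately show ?thesis by (intro AE_I'[of "\<Union>F'"]) auto
qed

text \<open>
  The ball of radius \<open>3 s\<close> around \<open>m\<close> lies in \<open>ball x (5 s)\<close>, and the ball of radius \<open>s / sqrt (n - 1)\<close>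
  contains \<open>ball x (a s)\<close> with \<open>a = 1 / sqrt (n - 1) - 1 / sqrt n\<close>; regularity at \<open>x\<close> is iterated until
  the radius \<open>5 s\<close> has shrunk below \<open>a s\<close>.
\<close>

lemma regular_cball_ratio:
  fixes \<mu> :: "'a::euclidean_space measure"
  assumes \<mu>: "finite_measure \<mu>" "sets \<mu> = sets borel"
    and "regular \<mu> A" and n: "n \<ge> 2"
  shows "\<exists>\<kappa>::nat. \<exists>s\<^sub>0>0. \<forall>x\<in>A. \<forall>m s. 0 < s \<and> s \<le> s\<^sub>0 \<and> norm (x - m) \<le> s / sqrt (real n) \<longrightarrow>
    measure \<mu> (cball m (3 * s)) \<le> \<kappa> * measure \<mu> (cball m (s / sqrt (real n - 1)))"
proof -
  interpret finite_measure \<mu> by fact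
  obtain \<delta> \<sigma> r\<^sub>0 where reg: "regular_with \<mu> A \<delta> \<sigma> r\<^sub>0"
    using assms(3) by (auto simp: regular_def)
  then have par: "0 < \<delta>" "\<delta> < 1" "0 < \<sigma>" "0 < r\<^sub>0" by (auto simp: regular_with_def)
  define a where "a = 1 / sqrt (real n - 1) - 1 / sqrt (real n)"
  have a: "a > 0" using n by (simp add: a_def divide_strict_left_mono)
  obtain k where k: "\<delta> ^ k < a / 5"
    using real_arch_pow_inv[of "a / 5" \<delta>] par a by auto
  obtain \<kappa> :: nat where \<kappa>: "1 / \<sigma> ^ k \<le> \<kappa>" using real_arch_simple by blast
  have "measure \<mu> (cball m (3 * s)) \<le> \<kappa> * measure \<mu> (cball m (s / sqrt (real n - 1)))"
    if x: "x \<in> A" and s: "0 < s" "s \<le> r\<^sub>0 / 5" and xm: "norm (x - m) \<le> s / sqrt (real n)" for x m s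
  proof -
    have "s / sqrt (real n) \<le> s" using s n by (simp add: field_simps)
    then have "dist x m + 3 * s < 5 * s" using xm s by (simp add: dist_norm)
    have "cball m (3 * s) \<subseteq> ball x (5 * s)"
    proof
      fix z assume "z \<in> cball m (3 * s)"
      with \<open>dist x m + 3 * s < 5 * s\<close> show "z \<in> ball x (5 * s)"
        using dist_triangle[of x z m] by simp
    qed
    then have "measure \<mu> (cball m (3 * s)) \<le> measure \<mu> (ball x (5 * s))"
      by (intro finite_measure_mono) (auto simp: \<mu>)
    also have "\<dots> = (1 / \<sigma> ^ k) * (\<sigma> ^ k * measure \<mu> (ball x (5 * s)))"
      using par by simp
    also have "\<dots> \<le> (1 / \<sigma> ^ k) * measure \<mu> (ball x (5 * s * \<delta> ^ k))"
      using regular_iterate[OF \<mu> reg x, of "5 * s" k] s par by (intro mult_left_mono) auto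
    also have "\<dots> \<le> \<kappa> * measure \<mu> (ball x (5 * s * \<delta> ^ k))"
      by (intro mult_right_mono \<kappa>) auto
    also have "\<dots> \<le> \<kappa> * measure \<mu> (cball m (s / sqrt (real n - 1)))"
    proof (intro mult_left_mono finite_measure_mono)
      have "5 * s * \<delta> ^ k \<le> s * a" using k s by simp
      also have "\<dots> = s / sqrt (real n - 1) - s / sqrt (real n)" by (simp add: a_def algebra_simps)
      finally have *: "5 * s * \<delta> ^ k + dist m x \<le> s / sqrt (real n - 1)"
        using xm by (simp add: dist_norm norm_minus_commute)
      show "ball x (5 * s * \<delta> ^ k) \<subseteq> cball m (s / sqrt (real n - 1))"
      proof
        fix z assume "z \<in> ball x (5 * s * \<delta> ^ k)"
        with * show "z \<in> cball m (s / sqrt (real n - 1))"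
          using dist_triangle[of m z x] by simp
      qed
    qed (auto simp: \<mu>)
    finally show ?thesis .
  qed
  then show ?thesis using par by (intro exI[of _ \<kappa>] exI[of _ "r\<^sub>0 / 5"]) auto
qed


section \<open>Deterministic convergence of cores\<close>

text \<open>
  The steps need to be controlled only while the sequence is close to \<open>\<phi>\<close>: once it is very close to
  \<open>\<phi>\<close> at a late time, the remaining sum of the \<open>b t\<close> is too small for it to leave the controlled
  region.
\<close>

lemma tendsto_recurrent:
  fixes m :: "nat \<Rightarrow> 'a::metric_space"
  assumes b: "summable b" "\<And>t. b t \<ge> 0" and "\<gamma> > 0"
    and step: "\<And>t. t \<ge> T\<^sub>0 \<Longrightarrow> dist (m t) \<phi> < \<gamma> \<Longrightarrow> dist (m (Suc t)) (m t) \<le> b t"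
    and rec: "\<And>\<epsilon> T. \<epsilon> > 0 \<Longrightarrow> \<exists>t\<ge>T. dist (m t) \<phi> < \<epsilon>"
  shows "m \<longlonglongrightarrow> \<phi>"
  unfolding lim_sequentially
proof safe
  fix e :: real assume "e > 0"
  define \<epsilon> where "\<epsilon> = min e \<gamma>"
  have "\<epsilon> > 0" using \<open>e > 0\<close> \<open>\<gamma> > 0\<close> by (simp add: \<epsilon>_def)
  then obtain T where T: "\<And>i j. i \<ge> T \<Longrightarrow> norm (sum b {i..<j}) < \<epsilon> / 2"
    using b(1) unfolding summable_Cauchy by (meson half_gt_zero)
  obtain u where u: "u \<ge> max T T\<^sub>0" "dist (m u) \<phi> < \<epsilon> / 2"
    using rec[of "\<epsilon> / 2"] \<open>\<epsilon> > 0\<close> by (metis half_gt_zero)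
  have "dist (m t) \<phi> \<le> dist (m u) \<phi> + sum b {u..<t}" if "t \<ge> u" for t
    using that
  proof (induction t rule: dec_induct)
    case (step t)
    have "sum b {u..<t} < \<epsilon> / 2" using T[of u t] u by auto
    then have "dist (m t) \<phi> < \<gamma>" using step u by (simp add: \<epsilon>_def)
    then have "dist (m (Suc t)) (m t) \<le> b t" using assms(4)[of t] u step by simp
    then have "dist (m (Suc t)) \<phi> \<le> b t + dist (m t) \<phi>"
      using dist_triangle[of "m (Suc t)" \<phi> "m t"] by linarith
    then show ?case using step by simp
  qed simp
  moreover have "sum b {u..<t} < \<epsilon> / 2" for t using T[of u t] u by auto
  ultimately have "dist (m t) \<phi> < \<epsilon> / 2 + \<epsilon> / 2" if "t \<ge> u" for t
    using that u(2) add_strict_mono order.strict_trans1 by meson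
  then have "dist (m t) \<phi> < e" if "t \<ge> u" for t
    using that by (force simp: \<epsilon>_def)
  then show "\<exists>u. \<forall>t\<ge>u. dist (m t) \<phi> < e" by blast
qed

lemma config_tendsto_centre:
  fixes C :: "nat \<Rightarrow> 'a::euclidean_space multiset"
  assumes "\<And>t. C t \<noteq> {#}" "(\<lambda>t. sqrt (G (C t))) \<longlonglongrightarrow> 0" "(\<lambda>t. centre (C t)) \<longlonglongrightarrow> \<phi>"
  shows "config_tendsto C \<phi>"
  unfolding config_tendsto_def
proof (rule tendsto_sandwich[where f="\<lambda>_. 0" and h="\<lambda>t. sqrt (G (C t)) + dist (centre (C t)) \<phi>"])
  have "0 \<le> (MAX x\<in>set_mset (C t). norm (x - \<phi>)) \<and>
      (MAX x\<in>set_mset (C t). norm (x - \<phi>)) \<le> sqrt (G (C t)) + dist (centre (C t)) \<phi>" for t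
  proof
    obtain x where "x \<in># C t" using assms(1)[of t] by blast
    then show "0 \<le> (MAX x\<in>set_mset (C t). norm (x - \<phi>))"
      by (meson Max_ge finite_imageI finite_set_mset image_eqI norm_ge_zero order_trans)
    have "norm (x - \<phi>) \<le> sqrt (G (C t)) + dist (centre (C t)) \<phi>" if "x \<in># C t" for x
      using norm_centre_le[OF that] unfolding dist_norm by norm
    then show "(MAX x\<in>set_mset (C t). norm (x - \<phi>)) \<le> sqrt (G (C t)) + dist (centre (C t)) \<phi>"
      using assms(1)[of t] by (intro Max.boundedI) auto
  qed
  then show "\<forall>\<^sub>F t in sequentially. 0 \<le> (MAX x\<in>set_mset (C t). norm (x - \<phi>))"
    "\<forall>\<^sub>F t in sequentially. (MAX x\<in>set_mset (C t). norm (x - \<phi>)) \<le>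
      sqrt (G (C t)) + dist (centre (C t)) \<phi>"
    by auto
  show "(\<lambda>t. sqrt (G (C t)) + dist (centre (C t)) \<phi>) \<longlonglongrightarrow> 0"
    using tendsto_add[OF assms(2) tendsto_dist[OF assms(3) tendsto_const[of \<phi>]]] by simp
qed simp

text \<open>
  The points \<open>x t\<close> lie well inside the balls whose measures occur in the series.  If the
  spread stayed above \<open>c > 0\<close>, the ball around the centre would contain \<open>ball \<phi> (a c / 2)\<close> whenever \<open>x t\<close>
  is close to \<open>\<phi>\<close>, and infinitely many terms of the series would exceed a positive constant.
\<close>

lemma spread_tendsto_0:
  fixes C :: "nat \<Rightarrow> 'a::euclidean_space multiset"
  assumes \<mu>: "finite_measure \<mu>" "sets \<mu> = sets borel"
    and size: "\<And>t. size (C t) = n" and n: "n \<ge> 2"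
    and dec: "decseq (\<lambda>t. sqrt (G (C t)))"
    and sum: "summable (\<lambda>t. sqrt (G (C t)) *
        measure \<mu> (cball (centre (C t)) (sqrt (G (C t)) / sqrt (real n - 1))))"
    and x: "\<And>t. norm (x t - centre (C t)) \<le> sqrt (G (C t)) / sqrt (real n)"
    and \<phi>: "\<phi> \<in> supp \<mu>"
    and rec: "\<And>\<epsilon> T. \<epsilon> > 0 \<Longrightarrow> \<exists>t\<ge>T. dist (x t) \<phi> < \<epsilon>"
  shows "(\<lambda>t. sqrt (G (C t))) \<longlonglongrightarrow> 0"
proof -
  interpret finite_measure \<mu> by fact
  define s where "s t = sqrt (G (C t))" for t
  \<comment> \<open>the room, in units of the spread, between \<open>x t\<close> and the boundary of the ball around the centre\<close>
  define a where "a = 1 / sqrt (real n - 1) - 1 / sqrt (real n)"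
  have a: "a > 0" using n by (simp add: a_def divide_strict_left_mono)
  have s0: "s t \<ge> 0" for t by (simp add: s_def G_nonneg)
  obtain c where c: "s \<longlonglongrightarrow> c" "\<And>t. c \<le> s t"
    using decseq_convergent[of s 0] dec s0 by (auto simp: s_def[abs_def])
  have "c \<le> 0"
  proof (rule ccontr)
    assume "\<not> c \<le> 0"
    then have "c > 0" by simp
    define p where "p = measure \<mu> (ball \<phi> (a * c / 2))"
    have "p > 0" using \<phi> \<open>c > 0\<close> a by (simp add: p_def supp_def)
    have "(\<lambda>t. s t * measure \<mu> (cball (centre (C t)) (s t / sqrt (real n - 1)))) \<longlonglongrightarrow> 0"
      using summable_LIMSEQ_zero[OF sum] by (simp add: s_def)
    then obtain T where T: "\<And>t. t \<ge> T \<Longrightarrow>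
        norm (s t * measure \<mu> (cball (centre (C t)) (s t / sqrt (real n - 1)))) < c * p"
      using \<open>p > 0\<close> \<open>c > 0\<close> LIMSEQ_D[of _ 0 "c * p"] by fastforce
    obtain t where t: "t \<ge> T" "dist (x t) \<phi> < a * c / 2"
      using rec[of "a * c / 2" T] a \<open>c > 0\<close> by auto
    have "ball \<phi> (a * c / 2) \<subseteq> cball (centre (C t)) (s t / sqrt (real n - 1))"
    proof
      fix z assume "z \<in> ball \<phi> (a * c / 2)"
      then have "dist z (x t) \<le> a * c"
        using t(2) dist_triangle[of z "x t" \<phi>] by (simp add: dist_commute)
      also have "\<dots> \<le> a * s t" using a c(2)[of t] by simp
      also have "\<dots> = s t / sqrt (real n - 1) - s t / sqrt (real n)"
        by (simp add: a_def algebra_simps)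
      finally have "dist z (centre (C t)) \<le> s t / sqrt (real n - 1)"
        using x[of t] dist_triangle[of z "centre (C t)" "x t"] by (simp add: s_def dist_norm)
      then show "z \<in> cball (centre (C t)) (s t / sqrt (real n - 1))"
        by (simp add: dist_commute)
    qed
    then have "p \<le> measure \<mu> (cball (centre (C t)) (s t / sqrt (real n - 1)))"
      unfolding p_def by (intro finite_measure_mono) (auto simp: \<mu>)
    then have "c * p \<le> s t * measure \<mu> (cball (centre (C t)) (s t / sqrt (real n - 1)))"
      using c(2)[of t] s0[of t] \<open>p > 0\<close> by (intro mult_mono) auto
    then show False using T[OF t(1)] by simp
  qed
  moreover have "c \<ge> 0" using c(1) s0 by (intro LIMSEQ_le_const) auto
  ultimately show ?thesis using c(1) by (simp add: s_def[abs_def])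
qed

text \<open>
  The deterministic half of the theorem: the configurations \<open>W t\<close> are arbitrary, and what the randomness
  of the draws contributes is contained in the assumption on the support and the two series.
\<close>

lemma core_sequence_converges:
  fixes C W :: "nat \<Rightarrow> 'a::euclidean_space multiset"
  assumes \<mu>: "finite_measure \<mu>" "sets \<mu> = sets borel"
    and size: "\<And>t. size (C t) = n" "\<And>t. size (W t) = K" and n: "n \<ge> 2" "K < n"
    and core: "\<And>t. C (Suc t) \<in> cores K (C t + W t)"
    and supp: "\<And>t. set_mset (C t) \<subseteq> supp \<mu>"
    and reg: "\<forall>x\<in>supp \<mu>. \<exists>\<gamma>>0. regular \<mu> (ball x \<gamma> \<inter> supp \<mu>)"
    and sum: "summable (\<lambda>t. sqrt (G (C t)) *
        measure \<mu> (cball (centre (C t)) (sqrt (G (C t)) / sqrt (real n - 1))))"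
    and changes: "\<And>\<kappa>::nat. summable (\<lambda>t. if
        measure \<mu> (cball (centre (C t)) (3 * sqrt (G (C t)))) \<le>
          \<kappa> * measure \<mu> (cball (centre (C t)) (sqrt (G (C t)) / sqrt (real n - 1))) \<and>
        (\<exists>z\<in>#W t. z \<in> cball (centre (C t)) (3 * sqrt (G (C t))))
        then sqrt (G (C t)) else 0)"
  shows "(\<exists>\<phi>. config_tendsto C \<phi>) \<or> config_tendsto_infinity C"
proof (rule disjCI)
  assume not_inf: "\<not> config_tendsto_infinity C"
  interpret finite_measure \<mu> by fact
  let ?m = "\<lambda>t. centre (C t)" and ?s = "\<lambda>t. sqrt (G (C t))"
  have ne: "C t \<noteq> {#}" for t using size(1)[of t] n by auto
  have s0: "?s t \<ge> 0" for t by (simp add: G_nonneg)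
  have dec: "decseq ?s"
    using core_G_decreases[OF core size(2)] by (intro decseq_SucI) auto
  \<comment> \<open>a core point, unlike the centre, lies in the support, so limit points of the sequence \<open>x\<close> do too\<close>
  obtain x where x: "\<And>t. x t \<in># C t" "\<And>t. norm (x t - ?m t) \<le> ?s t / sqrt (real n)"
    using exists_point_near_centre[OF ne] size(1) by metis
  have xm: "norm (x t - ?m t) \<le> ?s t" for t using norm_centre_le[OF x(1)] .
  obtain R where R: "\<exists>\<^sub>F t in sequentially. (MIN y\<in>set_mset (C t). norm y) < R"
    using not_inf unfolding config_tendsto_infinity_def filterlim_at_top
    by (auto simp: not_eventually not_le)
  let ?R = "R + 2 * ?s 0"
  have "norm (x t) \<le> ?R" if less: "(MIN y\<in>set_mset (C t). norm y) < R" for t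
  proof -
    have "(MIN y\<in>set_mset (C t). norm y) \<in> norm ` set_mset (C t)"
      using ne[of t] by (intro Min_in) auto
    then obtain y where y: "y \<in># C t" "norm y < R" using less by auto
    have "?s t \<le> ?s 0" using dec by (simp add: decseq_def)
    moreover have "norm (x t) \<le> norm y + norm (x t - ?m t) + norm (y - ?m t)" by norm
    ultimately show ?thesis using y xm[of t] norm_centre_le[OF y(1)] by linarith
  qed
  with R have "\<exists>\<^sub>F t in sequentially. norm (x t) \<le> ?R"
    by (rule frequently_elim1)
  then have inf: "infinite {t. norm (x t) \<le> ?R}"
    by (simp add: frequently_cofinite flip: cofinite_eq_sequentially)
  define e where "e = enumerate {t. norm (x t) \<le> ?R}"
  have e: "strict_mono e" "\<And>i. norm (x (e i)) \<le> ?R"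
    using enumerate_in_set[OF inf] strict_mono_enumerate[OF inf] by (auto simp: e_def)
  then have "bounded (range (x \<circ> e))"
    by (auto simp: bounded_iff)
  then obtain \<phi> r where r: "strict_mono r" "((x \<circ> e) \<circ> r) \<longlonglongrightarrow> \<phi>"
    using bounded_imp_convergent_subsequence by blast
  have "\<phi> \<in> supp \<mu>"
    by (rule closed_sequentially[OF closed_supp[OF \<mu>] _ r(2)]) (use supp x(1) in auto)
  have rec: "\<exists>t\<ge>T. dist (x t) \<phi> < \<epsilon>" if "\<epsilon> > 0" for \<epsilon> T
  proof -
    have "\<forall>\<^sub>F i in sequentially. dist ((x \<circ> e \<circ> r) i) \<phi> < \<epsilon>" using tendstoD[OF r(2) that] .
    then obtain i where i: "i \<ge> T" "dist ((x \<circ> e \<circ> r) i) \<phi> < \<epsilon>"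
      unfolding eventually_sequentially by (meson nle_le)
    moreover have "i \<le> e (r i)"
      using seq_suble[OF e(1), of "r i"] seq_suble[OF r(1), of i] by simp
    ultimately show ?thesis by (intro exI[of _ "e (r i)"]) auto
  qed
  have s_lim: "?s \<longlonglongrightarrow> 0"
    by (rule spread_tendsto_0[OF \<mu> size(1) n(1) dec sum x(2) \<open>\<phi> \<in> supp \<mu>\<close> rec])
  obtain \<gamma> where "\<gamma> > 0" "regular \<mu> (ball \<phi> \<gamma> \<inter> supp \<mu>)"
    using reg \<open>\<phi> \<in> supp \<mu>\<close> by blast
  from regular_cball_ratio[OF \<mu> this(2) n(1)] obtain \<kappa> :: nat and s\<^sub>0 where "s\<^sub>0 > 0"
    and \<kappa>: "\<And>y m s. \<lbrakk>y \<in> ball \<phi> \<gamma> \<inter> supp \<mu>; 0 < s; s \<le> s\<^sub>0; norm (y - m) \<le> s / sqrt (real n)\<rbrakk> \<Longrightarrow>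
      measure \<mu> (cball m (3 * s)) \<le> \<kappa> * measure \<mu> (cball m (s / sqrt (real n - 1)))"
    by metis
  define b where "b t = (if measure \<mu> (cball (?m t) (3 * ?s t)) \<le>
        \<kappa> * measure \<mu> (cball (?m t) (?s t / sqrt (real n - 1))) \<and>
        (\<exists>z\<in>#W t. z \<in> cball (?m t) (3 * ?s t)) then ?s t else 0)" for t
  have "\<forall>\<^sub>F t in sequentially. ?s t < min s\<^sub>0 (\<gamma> / 2)"
    using order_tendstoD(2)[OF s_lim, of "min s\<^sub>0 (\<gamma> / 2)"] \<open>\<gamma> > 0\<close> \<open>s\<^sub>0 > 0\<close> by simp
  then obtain T where T: "\<And>t. t \<ge> T \<Longrightarrow> ?s t < s\<^sub>0 \<and> ?s t < \<gamma> / 2"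
    by (auto simp: eventually_sequentially)
  have "?m \<longlonglongrightarrow> \<phi>"
  proof (rule tendsto_recurrent)
    show "summable (\<lambda>t. 2 * b t)"
      unfolding b_def by (intro summable_mult changes)
    show "2 * b t \<ge> 0" for t using s0[of t] by (simp add: b_def)
    show "\<gamma> / 2 > 0" using \<open>\<gamma> > 0\<close> by simp
    show "dist (?m (Suc t)) (?m t) \<le> 2 * b t" if t: "t \<ge> T" "dist (?m t) \<phi> < \<gamma> / 2" for t
    proof (cases "C (Suc t) = C t \<or> ?s t = 0")
      case True
      then show ?thesis
        using core_centre_move[OF core size(2), of t] size(1)[of t] n(2) by (auto simp: b_def)
    next
      case False
      then have s: "?s t > 0" using s0[of t] by simp
      have "dist (x t) \<phi> < \<gamma>"
        using xm[of t] T[OF t(1)] t(2) dist_triangle[of "x t" \<phi> "?m t"] by (simp add: dist_norm)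
      then have "x t \<in> ball \<phi> \<gamma> \<inter> supp \<mu>"
        using supp x(1)[of t] by (auto simp: dist_commute)
      from \<kappa>[OF this s _ x(2)] T[OF t(1)]
      have "measure \<mu> (cball (?m t) (3 * ?s t)) \<le>
          \<kappa> * measure \<mu> (cball (?m t) (?s t / sqrt (real n - 1)))" by simp
      moreover have "\<exists>z\<in>#W t. z \<in> cball (?m t) (3 * ?s t)"
        using core_change[OF core size(2), of t] size(1)[of t] n(2) False
        by (auto simp: dist_norm norm_minus_commute)
      ultimately have "b t = ?s t" by (simp add: b_def)
      then show ?thesis
        using core_centre_move[OF core size(2), of t] size(1)[of t] n(2) by simp
    qed
    show "\<exists>t\<ge>T'. dist (?m t) \<phi> < \<epsilon>" if \<epsilon>: "\<epsilon> > 0" for \<epsilon> T'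
    proof -
      have "\<forall>\<^sub>F t in sequentially. ?s t < \<epsilon> / 2"
        using order_tendstoD(2)[OF s_lim, of "\<epsilon> / 2"] \<epsilon> by simp
      then obtain U where U: "\<And>t. t \<ge> U \<Longrightarrow> ?s t < \<epsilon> / 2" by (auto simp: eventually_sequentially)
      obtain t where t: "t \<ge> max T' U" "dist (x t) \<phi> < \<epsilon> / 2"
        using rec[of "\<epsilon> / 2" "max T' U"] \<epsilon> by auto
      then have "dist (?m t) \<phi> < \<epsilon>"
        using U[of t] xm[of t] dist_triangle[of "?m t" \<phi> "x t"]
        by (simp add: dist_norm norm_minus_commute)
      then show ?thesis using t(1) by (intro exI[of _ t]) auto
    qed
  qed
  then show "\<exists>\<phi>. config_tendsto C \<phi>"
    using config_tendsto_centre[OF ne s_lim] by blast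
qed


section \<open>Convergence of configurations in countable terms\<close>

lemma sum_mset_le_size:
  fixes f :: "'a \<Rightarrow> real" and c :: real
  shows "(\<And>x. x \<in># C \<Longrightarrow> f x \<le> c) \<Longrightarrow> (\<Sum>x\<in>#C. f x) \<le> size C * c"
proof (induction C)
  case (add x C)
  then have "f x \<le> c" "(\<Sum>x\<in>#C. f x) \<le> size C * c" by auto
  then show ?case by (simp add: algebra_simps)
qed simp

text \<open>
  In this form the existence of a limit \<open>\<phi>\<close>, an uncountable union, becomes the Cauchy property of the
  centres, which is visibly an event.
\<close>

lemma config_tendsto_iff:
  fixes C :: "nat \<Rightarrow> 'a::euclidean_space multiset"
  assumes size: "\<And>t. size (C t) = n" and n: "n > 0"
  shows "config_tendsto C \<phi> \<longleftrightarrow>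
    (\<lambda>t. sqrt (G (C t))) \<longlonglongrightarrow> 0 \<and> (\<lambda>t. centre (C t)) \<longlonglongrightarrow> \<phi>"
proof
  have ne: "C t \<noteq> {#}" for t using size[of t] n by auto
  show "config_tendsto C \<phi>" if "(\<lambda>t. sqrt (G (C t))) \<longlonglongrightarrow> 0 \<and> (\<lambda>t. centre (C t)) \<longlonglongrightarrow> \<phi>"
    using config_tendsto_centre[of C \<phi>] ne that by simp
  assume "config_tendsto C \<phi>"
  moreover define R where "R t = (MAX x\<in>set_mset (C t). norm (x - \<phi>))" for t
  ultimately have R: "R \<longlonglongrightarrow> 0" unfolding config_tendsto_def R_def[abs_def] by simp
  have le: "norm (x - \<phi>) \<le> R t" if "x \<in># C t" for x t
    using that by (auto simp: R_def)
  have R0: "0 \<le> R t" for t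
  proof -
    obtain x where "x \<in># C t" using ne[of t] by blast
    then show ?thesis using le[of x t] norm_ge_zero[of "x - \<phi>"] by linarith
  qed
  have sq: "G (C t) + n * (norm (centre (C t) - \<phi>))\<^sup>2 \<le> n * (R t)\<^sup>2" for t
  proof -
    have "(\<Sum>x\<in>#C t. (norm (x - \<phi>))\<^sup>2) \<le> size (C t) * (R t)\<^sup>2"
      by (rule sum_mset_le_size) (auto intro: power_mono le)
    then show ?thesis by (simp add: sum_sq_dist_eq_G size)
  qed
  have "sqrt (G (C t)) \<le> sqrt n * R t" for t
  proof -
    have "G (C t) \<le> n * (R t)\<^sup>2"
      using sq[of t] by (smt (verit) mult_nonneg_nonneg of_nat_0_le_iff zero_le_power2)
    then have "sqrt (G (C t)) \<le> sqrt (n * (R t)\<^sup>2)" by simp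
    then show ?thesis using R0[of t] by (simp add: real_sqrt_mult)
  qed
  then have "\<forall>\<^sub>F t in sequentially. norm (sqrt (G (C t))) \<le> sqrt n * R t"
    by (simp add: G_nonneg)
  then have s: "(\<lambda>t. sqrt (G (C t))) \<longlonglongrightarrow> 0"
    by (rule Lim_null_comparison[OF _ tendsto_mult_right_zero[OF R]])
  have "dist (centre (C t)) \<phi> \<le> R t" for t
  proof -
    have "n * (norm (centre (C t) - \<phi>))\<^sup>2 \<le> n * (R t)\<^sup>2"
      using sq[of t] G_nonneg[of "C t"] by linarith
    then show ?thesis using n R0[of t] by (simp add: dist_norm power2_le_iff_abs_le)
  qed
  then have "\<forall>\<^sub>F t in sequentially. norm (dist (centre (C t)) \<phi>) \<le> R t"
    by simp
  then have "(\<lambda>t. dist (centre (C t)) \<phi>) \<longlonglongrightarrow> 0"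
    by (rule Lim_null_comparison[OF _ R])
  then show "(\<lambda>t. sqrt (G (C t))) \<longlonglongrightarrow> 0 \<and> (\<lambda>t. centre (C t)) \<longlonglongrightarrow> \<phi>"
    using s tendsto_dist_iff by blast
qed

lemma tendsto_0_set_measurable:
  fixes f :: "nat \<Rightarrow> 'w \<Rightarrow> real"
  assumes [measurable]: "\<And>t. f t \<in> borel_measurable M"
  shows "{\<omega> \<in> space M. (\<lambda>t. f t \<omega>) \<longlonglongrightarrow> 0} \<in> sets M"
proof -
  have "(\<lambda>t. f t \<omega>) \<longlonglongrightarrow> 0 \<longleftrightarrow> (\<forall>k::nat. \<exists>T. \<forall>t\<ge>T. \<bar>f t \<omega>\<bar> < 1 / Suc k)" for \<omega>
  proof
    assume lim: "(\<lambda>t. f t \<omega>) \<longlonglongrightarrow> 0"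
    show "\<forall>k::nat. \<exists>T. \<forall>t\<ge>T. \<bar>f t \<omega>\<bar> < 1 / Suc k"
    proof
      fix k :: nat
      show "\<exists>T. \<forall>t\<ge>T. \<bar>f t \<omega>\<bar> < 1 / Suc k"
        using LIMSEQ_D[OF lim, of "1 / Suc k"] by simp
    qed
  next
    assume *: "\<forall>k::nat. \<exists>T. \<forall>t\<ge>T. \<bar>f t \<omega>\<bar> < 1 / Suc k"
    show "(\<lambda>t. f t \<omega>) \<longlonglongrightarrow> 0"
    proof (rule LIMSEQ_I)
      fix e :: real assume "e > 0"
      then obtain k where "1 / Suc k < e" using nat_approx_posE by blast
      moreover obtain T where "\<forall>t\<ge>T. \<bar>f t \<omega>\<bar> < 1 / Suc k" using * by blast
      ultimately show "\<exists>T. \<forall>t\<ge>T. norm (f t \<omega> - 0) < e"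
        by (intro exI[of _ T]) (auto intro: less_trans)
    qed
  qed
  then show ?thesis by simp
qed

lemma config_tendsto_infinity_iff:
  fixes C :: "nat \<Rightarrow> 'a::euclidean_space multiset"
  assumes ne: "\<And>t. C t \<noteq> {#}"
  shows "config_tendsto_infinity C \<longleftrightarrow>
    (\<forall>k::nat. \<exists>T. \<forall>t\<ge>T. size {#x \<in># C t. x \<in> ball 0 (real k)#} = 0)"
proof -
  have eq: "size {#x \<in># C t. x \<in> ball 0 r#} = 0 \<longleftrightarrow> r \<le> (MIN x\<in>set_mset (C t). norm x)" for t r
    using ne[of t] by (auto simp: not_less)
  show ?thesis
    unfolding config_tendsto_infinity_def filterlim_at_top eventually_sequentially eq
  proof
    assume *: "\<forall>k::nat. \<exists>T. \<forall>t\<ge>T. real k \<le> (MIN x\<in>set_mset (C t). norm x)"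
    show "\<forall>r. \<exists>T. \<forall>t\<ge>T. r \<le> (MIN x\<in>set_mset (C t). norm x)"
    proof
      fix r :: real
      obtain k :: nat where "r \<le> k" using real_arch_simple by blast
      moreover obtain T where "\<forall>t\<ge>T. real k \<le> (MIN x\<in>set_mset (C t). norm x)" using * by blast
      ultimately show "\<exists>T. \<forall>t\<ge>T. r \<le> (MIN x\<in>set_mset (C t). norm x)"
        by (intro exI[of _ T]) (auto intro: order_trans)
    qed
  qed blast
qed


section \<open>The process and its independent draws\<close>

locale jante_dynamics = jante_process M N K \<mu> X Y Z
  for M :: "'w measure"
  and N K :: nat
  and \<mu> :: "'a::euclidean_space measure"
  and X Y :: "nat \<Rightarrow> 'w \<Rightarrow> 'a multiset"
  and Z :: "nat \<Rightarrow> nat \<Rightarrow> 'w \<Rightarrow> 'a" +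
  assumes K_pos: "K \<ge> 1" and K_less: "2 * K < N"
begin

definition n :: nat where "n = N - K"

text \<open>
  The index is the time of the core to which the points are added, one less than that of the draws.
\<close>

definition W :: "nat \<Rightarrow> 'w \<Rightarrow> 'a multiset" where
  "W t \<omega> = image_mset (\<lambda>j. Z (Suc t) j \<omega>) (mset_set {1..K})"

lemma n_bounds: "n \<ge> 2" "K < n"
  using K_pos K_less by (auto simp: n_def)

lemma size_W: "size (W t \<omega>) = K"
  by (simp add: W_def)

lemma size_X: "\<omega> \<in> space M \<Longrightarrow> size (X t \<omega>) = N"
proof (induction t)
  case 0
  then show ?case by (rule X0_size)
next
  case (Suc t)
  have "size (Y t \<omega>) = N - K" using core_size[OF core] Suc by simp
  then show ?case using step[OF Suc.prems, of t] K_less by simp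
qed

lemma size_Y: "\<omega> \<in> space M \<Longrightarrow> size (Y t \<omega>) = n"
  using core_size[OF core] size_X by (simp add: n_def)

lemma Y_step: "\<omega> \<in> space M \<Longrightarrow> Y (Suc t) \<omega> \<in> cores K (Y t \<omega> + W t \<omega>)"
  using core[of \<omega> "Suc t"] step[of \<omega> t] by (simp add: W_def)

lemma Z_measurable: "t \<ge> 1 \<Longrightarrow> j \<in> {1..K} \<Longrightarrow> Z t j \<in> borel_measurable M"
  using draws_indep by (auto simp: indep_vars_def2)

lemma prob_space_\<mu>: "prob_space \<mu>" and sets_\<mu>: "sets \<mu> = sets borel"
proof -
  have "distr M borel (Z 1 1) = \<mu>" using K_pos by (intro draws_law) auto
  then show "prob_space \<mu>" "sets \<mu> = sets borel"
    using prob_space_distr[OF Z_measurable[of 1 1]] K_pos by auto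
qed

sublocale \<mu>: prob_space \<mu> by (rule prob_space_\<mu>)

lemma finite_measure_\<mu>: "finite_measure \<mu>" by unfold_locales

lemma Y_in_supp: "AE \<omega> in M. \<forall>t. set_mset (Y t \<omega>) \<subseteq> supp \<mu>"
proof -
  have "AE \<omega> in M. \<forall>t. \<forall>j\<in>{1..K}. Z (Suc t) j \<omega> \<in> supp \<mu>"
  proof (intro AE_all_countable[THEN iffD2] AE_ball_countable[THEN iffD2] allI ballI)
    fix t j assume "j \<in> {1..K}"
    moreover have "supp \<mu> \<in> sets borel"
      using closed_supp[OF finite_measure_\<mu> sets_\<mu>] by (rule borel_closed)
    moreover have "AE z in distr M borel (Z (Suc t) j). z \<in> supp \<mu>"
      unfolding draws_law[OF _ \<open>j \<in> {1..K}\<close>, of "Suc t", simplified]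
      by (rule supp_full[OF finite_measure_\<mu> sets_\<mu>])
    ultimately show "AE \<omega> in M. Z (Suc t) j \<omega> \<in> supp \<mu>"
      using AE_distr_iff[OF Z_measurable[of "Suc t" j], of "\<lambda>z. z \<in> supp \<mu>"] by simp
  qed simp
  then show ?thesis
    using X0_supp AE_space
  proof eventually_elim
    case (elim \<omega>)
    have "set_mset (X t \<omega>) \<subseteq> supp \<mu>" for t
    proof (induction t)
      case (Suc t)
      have "set_mset (Y t \<omega>) \<subseteq> supp \<mu>"
        using set_mset_mono[OF core_subset[OF core[OF elim(3), of t]]] Suc by blast
      moreover have "set_mset (W t \<omega>) \<subseteq> supp \<mu>" using elim(1) by (auto simp: W_def)
      ultimately show ?case using step[OF elim(3), of t] by (auto simp: W_def)
    qed (use elim in simp)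
    then show ?case
      using set_mset_mono[OF core_subset[OF core[OF elim(3)]]] by blast
  qed
qed

text \<open>
  The core at time \<open>t\<close>, and with it the tie-breaking at time \<open>t\<close>, belongs to the past that is
  independent of later draws.
\<close>

lemma core_draw_distr:
  assumes j: "j \<in> {1..K}"
  shows "distr M config_algebra (Y t) \<Otimes>\<^sub>M \<mu> =
    distr M (config_algebra \<Otimes>\<^sub>M borel) (\<lambda>\<omega>. (Y t \<omega>, Z (Suc t) j \<omega>))"
proof (rule pair_measure_eqI)
  note [measurable] = Y_measurable
  have [measurable]: "Z (Suc t) j \<in> borel_measurable M" using Z_measurable[OF _ j] by simp
  show "sigma_finite_measure (distr M config_algebra (Y t))"
    by (intro prob_space_imp_sigma_finite prob_space_distr Y_measurable)
  show "sigma_finite_measure \<mu>" by unfold_locales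
  show "sets (distr M config_algebra (Y t) \<Otimes>\<^sub>M \<mu>) =
      sets (distr M (config_algebra \<Otimes>\<^sub>M borel) (\<lambda>\<omega>. (Y t \<omega>, Z (Suc t) j \<omega>)))"
    by (simp cong: sets_pair_measure_cong add: sets_\<mu>)
  fix A B assume "A \<in> sets (distr M config_algebra (Y t))" "B \<in> sets \<mu>"
  then have A[measurable]: "A \<in> sets config_algebra" and B[measurable]: "B \<in> sets borel"
    by (auto simp: sets_\<mu>)
  let ?EA = "Y t -` A \<inter> space M" and ?EB = "Z (Suc t) j -` B \<inter> space M"
  have "sets (past M K X Y Z t (Suc t)) = sigma_sets (space M)
     ({X 0 -` A \<inter> space M | A. A \<in> sets config_algebra} \<union>
      {Z s j -` B \<inter> space M | s j B. s \<in> {1..t} \<and> j \<in> {1..K} \<and> B \<in> sets borel} \<union>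
      {Y s -` A \<inter> space M | s A. s < Suc t \<and> A \<in> sets config_algebra})"
    unfolding past_def by (rule sets_measure_of) blast
  moreover have "?EA \<in> {Y s -` A \<inter> space M | s A. s < Suc t \<and> A \<in> sets config_algebra}"
    using A by blast
  ultimately have past: "?EA \<in> sets (past M K X Y Z t (Suc t))"
    by (simp only: UnI2 sigma_sets.Basic)
  have "sets (future M K Z t) = sigma_sets (space M)
     {Z s j -` B \<inter> space M | s j B. s > t \<and> j \<in> {1..K} \<and> B \<in> sets borel}"
    unfolding future_def by (rule sets_measure_of) blast
  moreover have "?EB \<in> {Z s j -` B \<inter> space M | s j B. s > t \<and> j \<in> {1..K} \<and> B \<in> sets borel}"
    using B j by blast
  ultimately have "?EB \<in> sets (future M K Z t)"
    by (simp only: sigma_sets.Basic)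
  with past have "prob (?EA \<inter> ?EB) = prob ?EA * prob ?EB"
    by (rule indep_setD[OF future_indep[of t]])
  moreover have "emeasure \<mu> B = emeasure M ?EB"
    using draws_law[OF _ j, of "Suc t"] emeasure_distr[of "Z (Suc t) j" M borel B] by simp
  moreover have "(\<lambda>\<omega>. (Y t \<omega>, Z (Suc t) j \<omega>)) -` (A \<times> B) \<inter> space M = ?EA \<inter> ?EB" by auto
  ultimately show "emeasure (distr M config_algebra (Y t)) A * emeasure \<mu> B =
      emeasure (distr M (config_algebra \<Otimes>\<^sub>M borel) (\<lambda>\<omega>. (Y t \<omega>, Z (Suc t) j \<omega>))) (A \<times> B)"
    by (simp add: emeasure_distr emeasure_eq_measure ennreal_mult)
qed

text \<open>
  Conditioning on the core: the event that the next draw falls into a ball depending on the core may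
  be replaced by the \<open>\<mu>\<close>-measure of this ball.
\<close>

lemma nn_integral_draw:
  fixes g :: "'a multiset \<Rightarrow> ennreal" and \<rho> :: "'a multiset \<Rightarrow> real"
  assumes j: "j \<in> {1..K}" and g[measurable]: "g \<in> borel_measurable config_algebra"
    and \<rho>[measurable]: "\<rho> \<in> borel_measurable config_algebra"
  shows "(\<integral>\<^sup>+\<omega>. g (Y t \<omega>) * indicator (cball (centre (Y t \<omega>)) (\<rho> (Y t \<omega>))) (Z (Suc t) j \<omega>) \<partial>M) =
    (\<integral>\<^sup>+\<omega>. g (Y t \<omega>) * emeasure \<mu> (cball (centre (Y t \<omega>)) (\<rho> (Y t \<omega>))) \<partial>M)"
proof -
  note [measurable] = centre_measurable Y_measurable Z_measurable[OF _ j]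
  have [measurable]: "Z (Suc t) j \<in> borel_measurable M" using Z_measurable[OF _ j] by simp
  define h where "h = (\<lambda>(C, z). g C * indicator (cball (centre C) (\<rho> C)) z)"
  have h_eq: "h = (\<lambda>(C, z). g C * indicator {p. dist (centre (fst p)) (snd p) \<le> \<rho> (fst p)} (C, z))"
    by (auto simp: h_def fun_eq_iff indicator_def)
  have "{p. dist (centre (fst p)) (snd p) \<le> \<rho> (fst p)} \<in> sets (config_algebra \<Otimes>\<^sub>M borel)"
  proof -
    have "{p \<in> space (config_algebra \<Otimes>\<^sub>M borel). dist (centre (fst p)) (snd p) \<le> \<rho> (fst p)}
        \<in> sets (config_algebra \<Otimes>\<^sub>M (borel :: 'a measure))"
      by measurable
    then show ?thesis by (simp add: space_pair_measure config_algebra_def)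
  qed
  then have [measurable]: "h \<in> borel_measurable (config_algebra \<Otimes>\<^sub>M borel)"
    unfolding h_eq by measurable
  have "sets (config_algebra \<Otimes>\<^sub>M \<mu>) = sets (config_algebra \<Otimes>\<^sub>M (borel :: 'a measure))"
    by (intro sets_pair_measure_cong refl sets_\<mu>)
  then have h\<mu>: "h \<in> borel_measurable (distr M config_algebra (Y t) \<Otimes>\<^sub>M \<mu>)"
    using \<open>h \<in> _\<close> by (subst measurable_cong_sets[of _ "config_algebra \<Otimes>\<^sub>M (borel :: 'a measure)" _ borel])
      (auto intro!: sets_pair_measure_cong simp: sets_\<mu>)
  have "(\<integral>\<^sup>+\<omega>. h (Y t \<omega>, Z (Suc t) j \<omega>) \<partial>M) =
      integral\<^sup>N (distr M (config_algebra \<Otimes>\<^sub>M borel) (\<lambda>\<omega>. (Y t \<omega>, Z (Suc t) j \<omega>))) h"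
    by (subst nn_integral_distr) auto
  also have "\<dots> = integral\<^sup>N (distr M config_algebra (Y t) \<Otimes>\<^sub>M \<mu>) h"
    by (simp add: core_draw_distr[OF j])
  also have "\<dots> = (\<integral>\<^sup>+C. \<integral>\<^sup>+z. h (C, z) \<partial>\<mu> \<partial>distr M config_algebra (Y t))"
    by (rule \<mu>.nn_integral_fst[symmetric, OF h\<mu>])
  also have "\<dots> = (\<integral>\<^sup>+\<omega>. \<integral>\<^sup>+z. h (Y t \<omega>, z) \<partial>\<mu> \<partial>M)"
    using \<mu>.borel_measurable_nn_integral_fst[OF h\<mu>] by (intro nn_integral_distr) auto
  also have "\<dots> = (\<integral>\<^sup>+\<omega>. g (Y t \<omega>) * emeasure \<mu> (cball (centre (Y t \<omega>)) (\<rho> (Y t \<omega>))) \<partial>M)"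
    by (simp add: h_def nn_integral_cmult_indicator sets_\<mu>)
  finally show ?thesis by (simp add: h_def)
qed

end


section \<open>The energy estimate\<close>

lemma AE_summable_of_nn_integral:
  fixes f :: "nat \<Rightarrow> 'w \<Rightarrow> ennreal"
  assumes [measurable]: "\<And>t. f t \<in> borel_measurable M" and "(\<Sum>t. \<integral>\<^sup>+\<omega>. f t \<omega> \<partial>M) < \<infinity>"
  shows "AE \<omega> in M. (\<Sum>t. f t \<omega>) \<noteq> \<infinity>"
  using assms(2) by (intro nn_integral_PInf_AE) (auto simp: nn_integral_suminf)

context jante_dynamics
begin

definition spread :: "'a multiset \<Rightarrow> real" where "spread C = sqrt (G C)"

text \<open>
  For a core, a draw in \<open>shrink_ball\<close> decreases the spread by a fixed factor (\<open>core_drop\<close>), and only a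
  draw in \<open>reach_ball\<close> can change the core (\<open>core_change\<close>).
\<close>

definition shrink_ball :: "'a multiset \<Rightarrow> 'a set" where
  "shrink_ball C = cball (centre C) (spread C / sqrt (real n - 1))"

definition reach_ball :: "'a multiset \<Rightarrow> 'a set" where
  "reach_ball C = cball (centre C) (3 * spread C)"

text \<open>
  The initial spread may have infinite expectation; the cutoff makes the energy estimate integrable.
  Since the spread never increases, on each path it has no effect for large \<open>L\<close>.
\<close>

definition capped :: "real \<Rightarrow> 'a multiset \<Rightarrow> real" where
  "capped L C = (if spread C \<le> L then spread C else 0)"

lemma spread_nonneg: "spread C \<ge> 0" and capped_nonneg: "capped L C \<ge> 0"
  by (auto simp: spread_def capped_def G_nonneg)

lemma spread_measurable[measurable]: "spread \<in> borel_measurable config_algebra"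
  unfolding spread_def[abs_def] using G_measurable by measurable

lemma capped_measurable[measurable]: "capped L \<in> borel_measurable config_algebra"
  unfolding capped_def[abs_def] by measurable

lemma emeasure_cball_measurable:
  assumes [measurable]: "\<rho> \<in> borel_measurable config_algebra"
  shows "(\<lambda>C. emeasure \<mu> (cball (centre C) (\<rho> C))) \<in> borel_measurable config_algebra"
proof -
  note [measurable] = centre_measurable
  have "{p \<in> space (config_algebra \<Otimes>\<^sub>M borel). dist (centre (fst p)) (snd p) \<le> \<rho> (fst p)}
      \<in> sets (config_algebra \<Otimes>\<^sub>M (borel :: 'a measure))" (is "?Q \<in> _")
    by measurable
  also have "sets (config_algebra \<Otimes>\<^sub>M (borel :: 'a measure)) = sets (config_algebra \<Otimes>\<^sub>M \<mu>)"
    by (intro sets_pair_measure_cong refl sets_\<mu>[symmetric])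
  finally have "(\<lambda>C. emeasure \<mu> (Pair C -` ?Q)) \<in> borel_measurable config_algebra"
    by (rule \<mu>.measurable_emeasure_Pair)
  moreover have "Pair C -` ?Q = cball (centre C) (\<rho> C)" for C
    by (auto simp: space_pair_measure config_algebra_def)
  ultimately show ?thesis by simp
qed

lemma emeasure_shrink_ball_measurable[measurable]: "(\<lambda>C. emeasure \<mu> (shrink_ball C)) \<in> borel_measurable config_algebra"
  and emeasure_reach_ball_measurable[measurable]: "(\<lambda>C. emeasure \<mu> (reach_ball C)) \<in> borel_measurable config_algebra"
  unfolding shrink_ball_def reach_ball_def by (rule emeasure_cball_measurable; measurable)+

lemma measure_shrink_ball_measurable[measurable]: "(\<lambda>C. measure \<mu> (shrink_ball C)) \<in> borel_measurable config_algebra"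
  and measure_reach_ball_measurable[measurable]: "(\<lambda>C. measure \<mu> (reach_ball C)) \<in> borel_measurable config_algebra"
  unfolding measure_def by measurable

lemma spread_decreases: "\<omega> \<in> space M \<Longrightarrow> spread (Y (Suc t) \<omega>) \<le> spread (Y t \<omega>)"
  using core_G_decreases[OF Y_step size_W] by (simp add: spread_def)

text \<open>
  The energy estimate on a single path, with potential \<open>min L (spread C)\<close>: each draw in the shrinking
  ball at a time when the cutoff is inactive costs at least the given fraction of the spread, and the
  potential starts at most at \<open>L\<close>.
\<close>

lemma sum_capped_hits_le:
  assumes "\<omega> \<in> space M" "L \<ge> 0"
  shows "(1 - sqrt (1 - 1 / (real n)\<^sup>2)) *
    (\<Sum>t<T. capped L (Y t \<omega>) * indicator (shrink_ball (Y t \<omega>)) (Z (Suc t) 1 \<omega>)) \<le>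
    L - min L (spread (Y T \<omega>))"
proof (induction T)
  case (Suc T)
  let ?\<theta> = "sqrt (1 - 1 / (real n)\<^sup>2)"
  let ?s = "spread (Y T \<omega>)" and ?s' = "spread (Y (Suc T) \<omega>)"
  have "(1 - ?\<theta>) * (capped L (Y T \<omega>) * indicator (shrink_ball (Y T \<omega>)) (Z (Suc T) 1 \<omega>)) \<le>
      min L ?s - min L ?s'"
  proof (cases "?s \<le> L \<and> Z (Suc T) 1 \<omega> \<in> shrink_ball (Y T \<omega>)")
    case True
    have "Z (Suc T) 1 \<omega> \<in># W T \<omega>" using K_pos by (simp add: W_def)
    then have "?s' \<le> ?\<theta> * ?s"
      using core_drop[OF Y_step[OF assms(1)] size_W, of T "Z (Suc T) 1 \<omega>"] True n_bounds
      by (simp add: spread_def shrink_ball_def size_Y[OF assms(1)] dist_norm norm_minus_commute)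
    then show ?thesis using True by (simp add: capped_def algebra_simps)
  next
    case False
    then show ?thesis using spread_decreases[OF assms(1), of T] by (auto simp: capped_def)
  qed
  with Suc show ?case by (simp add: distrib_left)
qed (use assms in simp)

text \<open>
  The expectation of the pathwise estimate, with the hits replaced by their conditional probabilities.
  Only the hits of draw number \<open>1\<close> are counted.
\<close>

lemma sum_capped_shrink_ball_finite:
  assumes L: "L \<ge> 0"
  shows "(\<Sum>t. \<integral>\<^sup>+\<omega>. ennreal (capped L (Y t \<omega>)) * emeasure \<mu> (shrink_ball (Y t \<omega>)) \<partial>M) < \<infinity>"
proof -
  let ?c = "1 - sqrt (1 - 1 / (real n)\<^sup>2)"
  have c: "?c > 0" using n_bounds by simp
  have 1: "1 \<in> {1..K}" using K_pos by simp
  note [measurable] = Y_measurable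
  have hit_measurable: "(\<lambda>\<omega>. ennreal (capped L (Y t \<omega>)) * indicator (shrink_ball (Y t \<omega>)) (Z (Suc t) 1 \<omega>))
      \<in> borel_measurable M" for t
  proof -
    note [measurable] = centre_measurable
    have [measurable]: "Z (Suc t) 1 \<in> borel_measurable M" using Z_measurable[OF _ 1] by simp
    have "(\<lambda>\<omega>. ennreal (capped L (Y t \<omega>)) * indicator (shrink_ball (Y t \<omega>)) (Z (Suc t) 1 \<omega>)) =
        (\<lambda>\<omega>. if dist (centre (Y t \<omega>)) (Z (Suc t) 1 \<omega>) \<le> spread (Y t \<omega>) / sqrt (real n - 1)
          then ennreal (capped L (Y t \<omega>)) else 0)"
      by (auto simp: fun_eq_iff shrink_ball_def indicator_def)
    also have "\<dots> \<in> borel_measurable M" by measurable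
    finally show ?thesis .
  qed
  have "(\<Sum>t<T. \<integral>\<^sup>+\<omega>. ennreal (capped L (Y t \<omega>)) * emeasure \<mu> (shrink_ball (Y t \<omega>)) \<partial>M) \<le> ennreal (L / ?c)" for T
  proof -
    have "(\<Sum>t<T. \<integral>\<^sup>+\<omega>. ennreal (capped L (Y t \<omega>)) * emeasure \<mu> (shrink_ball (Y t \<omega>)) \<partial>M) =
        (\<Sum>t<T. \<integral>\<^sup>+\<omega>. ennreal (capped L (Y t \<omega>)) * indicator (shrink_ball (Y t \<omega>)) (Z (Suc t) 1 \<omega>) \<partial>M)"
      using nn_integral_draw[OF 1, of "\<lambda>C. ennreal (capped L C)" "\<lambda>C. spread C / sqrt (real n - 1)"]
      by (simp add: shrink_ball_def)
    also have "\<dots> = (\<integral>\<^sup>+\<omega>. (\<Sum>t<T. ennreal (capped L (Y t \<omega>)) * indicator (shrink_ball (Y t \<omega>)) (Z (Suc t) 1 \<omega>)) \<partial>M)"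
      by (intro nn_integral_sum[symmetric] hit_measurable)
    also have "\<dots> \<le> (\<integral>\<^sup>+\<omega>. ennreal (L / ?c) \<partial>M)"
    proof (rule nn_integral_mono)
      fix \<omega> assume \<omega>: "\<omega> \<in> space M"
      let ?S = "\<Sum>t<T. capped L (Y t \<omega>) * indicator (shrink_ball (Y t \<omega>)) (Z (Suc t) 1 \<omega>)"
      have "?c * ?S \<le> L"
        using sum_capped_hits_le[OF \<omega> L, of T] L spread_nonneg[of "Y T \<omega>"] by linarith
      then have "?S \<le> L / ?c" using c by (simp add: pos_le_divide_eq mult.commute)
      moreover have "(\<Sum>t<T. ennreal (capped L (Y t \<omega>)) * indicator (shrink_ball (Y t \<omega>)) (Z (Suc t) 1 \<omega>)) = ennreal ?S"
        by (subst sum_ennreal[symmetric])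
          (auto simp: capped_nonneg ennreal_mult' ennreal_indicator intro!: sum.cong)
      ultimately show "(\<Sum>t<T. ennreal (capped L (Y t \<omega>)) * indicator (shrink_ball (Y t \<omega>)) (Z (Suc t) 1 \<omega>)) \<le> ennreal (L / ?c)"
        by (simp add: ennreal_leI)
    qed
    also have "\<dots> = ennreal (L / ?c)" by (simp add: emeasure_space_1)
    finally show ?thesis .
  qed
  then have "(\<Sum>t. \<integral>\<^sup>+\<omega>. ennreal (capped L (Y t \<omega>)) * emeasure \<mu> (shrink_ball (Y t \<omega>)) \<partial>M) \<le> ennreal (L / ?c)"
    by (intro suminf_le_const) auto
  then show ?thesis by (simp add: le_less_trans)
qed

text \<open>
  Where the measures of the two balls are comparable, a draw lands in the large one with at most \<open>\<kappa>\<close>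
  times the probability of the small one, which turns the previous bound into one on the times at
  which draw \<open>j\<close> may change the core.
\<close>

lemma sum_capped_reach_ball_finite:
  fixes \<kappa> :: nat
  assumes L: "L \<ge> 0" and j: "j \<in> {1..K}"
  shows "(\<Sum>t. \<integral>\<^sup>+\<omega>. ennreal (if measure \<mu> (reach_ball (Y t \<omega>)) \<le> \<kappa> * measure \<mu> (shrink_ball (Y t \<omega>))
      then capped L (Y t \<omega>) else 0) * indicator (reach_ball (Y t \<omega>)) (Z (Suc t) j \<omega>) \<partial>M) < \<infinity>"
proof -
  note [measurable] = Y_measurable
  let ?g = "\<lambda>C. if measure \<mu> (reach_ball C) \<le> \<kappa> * measure \<mu> (shrink_ball C) then capped L C else 0"
  have le: "ennreal (?g C) * emeasure \<mu> (reach_ball C) \<le> ennreal \<kappa> * (ennreal (capped L C) * emeasure \<mu> (shrink_ball C))" for C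
  proof -
    have "?g C * measure \<mu> (reach_ball C) \<le> \<kappa> * (capped L C * measure \<mu> (shrink_ball C))"
      using mult_left_mono[of "measure \<mu> (reach_ball C)" "\<kappa> * measure \<mu> (shrink_ball C)" "capped L C"]
      by (simp add: capped_nonneg mult_ac)
    then show ?thesis
      by (simp add: \<mu>.emeasure_eq_measure capped_nonneg flip: ennreal_mult'')
  qed
  have "(\<Sum>t. \<integral>\<^sup>+\<omega>. ennreal (?g (Y t \<omega>)) * indicator (reach_ball (Y t \<omega>)) (Z (Suc t) j \<omega>) \<partial>M) =
      (\<Sum>t. \<integral>\<^sup>+\<omega>. ennreal (?g (Y t \<omega>)) * emeasure \<mu> (reach_ball (Y t \<omega>)) \<partial>M)"
    using nn_integral_draw[OF j, of "\<lambda>C. ennreal (?g C)" "\<lambda>C. 3 * spread C"]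
    by (simp flip: reach_ball_def)
  also have "\<dots> \<le> (\<Sum>t. \<integral>\<^sup>+\<omega>. ennreal \<kappa> * (ennreal (capped L (Y t \<omega>)) * emeasure \<mu> (shrink_ball (Y t \<omega>))) \<partial>M)"
    by (intro suminf_le nn_integral_mono le) auto
  also have "\<dots> = ennreal \<kappa> * (\<Sum>t. \<integral>\<^sup>+\<omega>. ennreal (capped L (Y t \<omega>)) * emeasure \<mu> (shrink_ball (Y t \<omega>)) \<partial>M)"
    by (subst nn_integral_cmult) auto
  also have "\<dots> < \<infinity>"
    using sum_capped_shrink_ball_finite[OF L] by (simp add: ennreal_mult_less_top)
  finally show ?thesis .
qed

end


section \<open>Almost sure convergence\<close>

context jante_dynamics
begin

lemma AE_shrink_ball_summable:
  "AE \<omega> in M. summable (\<lambda>t. spread (Y t \<omega>) * measure \<mu> (shrink_ball (Y t \<omega>)))"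
proof -
  note [measurable] = Y_measurable
  have "AE \<omega> in M. \<forall>L::nat. (\<Sum>t. ennreal (capped L (Y t \<omega>)) * emeasure \<mu> (shrink_ball (Y t \<omega>))) \<noteq> \<infinity>"
    by (intro AE_all_countable[THEN iffD2] allI AE_summable_of_nn_integral sum_capped_shrink_ball_finite) auto
  then show ?thesis using AE_space
  proof eventually_elim
    case (elim \<omega>)
    \<comment> \<open>the cutoff is removed path by path, by choosing it above the initial spread\<close>
    obtain L :: nat where L: "spread (Y 0 \<omega>) \<le> L" using real_arch_simple by blast
    have cap: "capped L (Y t \<omega>) = spread (Y t \<omega>)" for t
      using decseqD[OF decseq_SucI[of "\<lambda>t. spread (Y t \<omega>)", OF spread_decreases[OF elim(2)]], of 0 t] L
      by (simp add: capped_def)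
    have "(\<Sum>t. ennreal (spread (Y t \<omega>) * measure \<mu> (shrink_ball (Y t \<omega>)))) \<noteq> \<top>"
      using elim(1)[rule_format, of L]
      by (simp add: cap \<mu>.emeasure_eq_measure spread_nonneg ennreal_mult)
    then show ?case
      by (intro summable_suminf_not_top) (simp_all add: spread_nonneg)
  qed
qed

lemma AE_reach_ball_summable:
  "AE \<omega> in M. \<forall>\<kappa>::nat. summable (\<lambda>t. if measure \<mu> (reach_ball (Y t \<omega>)) \<le> \<kappa> * measure \<mu> (shrink_ball (Y t \<omega>)) \<and>
      (\<exists>z\<in>#W t \<omega>. z \<in> reach_ball (Y t \<omega>)) then spread (Y t \<omega>) else 0)"
proof -
  note [measurable] = Y_measurable
  let ?f = "\<lambda>L \<kappa> j t \<omega>. ennreal (if measure \<mu> (reach_ball (Y t \<omega>)) \<le> real \<kappa> * measure \<mu> (shrink_ball (Y t \<omega>))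
      then capped L (Y t \<omega>) else 0) * indicator (reach_ball (Y t \<omega>)) (Z (Suc t) j \<omega>)"
  have "?f L \<kappa> j t \<in> borel_measurable M" if j: "j \<in> {1..K}" for L \<kappa> j t
  proof -
    note [measurable] = centre_measurable
    have [measurable]: "Z (Suc t) j \<in> borel_measurable M" using Z_measurable[OF _ j] by simp
    have "?f L \<kappa> j t = (\<lambda>\<omega>. if dist (centre (Y t \<omega>)) (Z (Suc t) j \<omega>) \<le> 3 * spread (Y t \<omega>)
          then ennreal (if measure \<mu> (reach_ball (Y t \<omega>)) \<le> real \<kappa> * measure \<mu> (shrink_ball (Y t \<omega>))
            then capped L (Y t \<omega>) else 0) else 0)"
      by (auto simp: fun_eq_iff reach_ball_def indicator_def)
    also have "\<dots> \<in> borel_measurable M" by measurable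
    finally show ?thesis .
  qed
  then have "AE \<omega> in M. \<forall>L::nat. \<forall>\<kappa>::nat. \<forall>j\<in>{1..K}. (\<Sum>t. ?f L \<kappa> j t \<omega>) \<noteq> \<infinity>"
    by (intro AE_all_countable[THEN iffD2] AE_ball_countable[THEN iffD2] allI ballI
        AE_summable_of_nn_integral sum_capped_reach_ball_finite) auto
  then show ?thesis using AE_space
  proof eventually_elim
    case (elim \<omega>)
    obtain L :: nat where L: "spread (Y 0 \<omega>) \<le> L" using real_arch_simple by blast
    have cap: "capped L (Y t \<omega>) = spread (Y t \<omega>)" for t
      using decseqD[OF decseq_SucI[of "\<lambda>t. spread (Y t \<omega>)", OF spread_decreases[OF elim(2)]], of 0 t] L
      by (simp add: capped_def)
    show ?case
    proof
      fix \<kappa> :: nat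
      let ?h = "\<lambda>j t. (if measure \<mu> (reach_ball (Y t \<omega>)) \<le> real \<kappa> * measure \<mu> (shrink_ball (Y t \<omega>))
        then spread (Y t \<omega>) else 0) * indicator (reach_ball (Y t \<omega>)) (Z (Suc t) j \<omega>)"
      have h0: "?h j t \<ge> 0" for j t by (simp add: spread_nonneg)
      have "summable (?h j)" if "j \<in> {1..K}" for j
      proof (rule summable_suminf_not_top[OF h0])
        have "ennreal (?h j t) = ?f L \<kappa> j t \<omega>" for t
          by (simp add: cap indicator_def)
        then show "(\<Sum>t. ennreal (?h j t)) \<noteq> \<top>"
          using elim(1)[rule_format, OF that, of \<kappa> L] by simp
      qed
      \<comment> \<open>the event that some draw lands in the large ball is bounded by the sum over the draws\<close>
      then have "summable (\<lambda>t. \<Sum>j\<in>{1..K}. ?h j t)" by (rule summable_sum)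
      then show "summable (\<lambda>t. if measure \<mu> (reach_ball (Y t \<omega>)) \<le> \<kappa> * measure \<mu> (shrink_ball (Y t \<omega>)) \<and>
          (\<exists>z\<in>#W t \<omega>. z \<in> reach_ball (Y t \<omega>)) then spread (Y t \<omega>) else 0)"
      proof (rule summable_comparison_test'[where N=0])
        fix t
        let ?lhs = "if measure \<mu> (reach_ball (Y t \<omega>)) \<le> \<kappa> * measure \<mu> (shrink_ball (Y t \<omega>)) \<and>
          (\<exists>z\<in>#W t \<omega>. z \<in> reach_ball (Y t \<omega>)) then spread (Y t \<omega>) else 0"
        have "?lhs \<le> (\<Sum>j\<in>{1..K}. ?h j t)"
        proof (cases "measure \<mu> (reach_ball (Y t \<omega>)) \<le> \<kappa> * measure \<mu> (shrink_ball (Y t \<omega>)) \<and>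
            (\<exists>z\<in>#W t \<omega>. z \<in> reach_ball (Y t \<omega>))")
          case True
          then obtain j where j: "j \<in> {1..K}" "Z (Suc t) j \<omega> \<in> reach_ball (Y t \<omega>)"
            by (auto simp: W_def)
          have "?lhs = ?h j t" using True j by simp
          also have "\<dots> \<le> (\<Sum>j\<in>{1..K}. ?h j t)"
            by (rule member_le_sum[OF j(1) h0]) simp
          finally show ?thesis .
        next
          case False
          then show ?thesis using sum_nonneg[of "{1..K}" "\<lambda>j. ?h j t", OF h0] by (simp only: if_False)
        qed
        moreover have "?lhs \<ge> 0" by (simp add: spread_nonneg)
        ultimately show "norm ?lhs \<le> (\<Sum>j\<in>{1..K}. ?h j t)"
          by (simp only: real_norm_def abs_of_nonneg)
      qed
    qed
  qed
qed

lemma AE_core_converges: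
  assumes reg: "\<forall>x\<in>supp \<mu>. \<exists>\<gamma>>0. regular \<mu> (ball x \<gamma> \<inter> supp \<mu>)"
  shows "AE \<omega> in M. (\<exists>\<phi>. config_tendsto (\<lambda>t. Y t \<omega>) \<phi>) \<or> config_tendsto_infinity (\<lambda>t. Y t \<omega>)"
  using Y_in_supp AE_shrink_ball_summable AE_reach_ball_summable AE_space
proof eventually_elim
  case (elim \<omega>)
  show ?case
  proof (rule core_sequence_converges[OF finite_measure_\<mu> sets_\<mu> _ _ n_bounds _ _ reg])
    show "size (Y t \<omega>) = n" "Y (Suc t) \<omega> \<in> cores K (Y t \<omega> + W t \<omega>)" for t
      using size_Y Y_step elim by auto
    show "size (W t \<omega>) = K" for t by (rule size_W)
    show "set_mset (Y t \<omega>) \<subseteq> supp \<mu>" for t using elim by blast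
  qed (use elim(2,3)[unfolded shrink_ball_def reach_ball_def spread_def] in blast)+
qed

text \<open>
  Probability one is claimed for the set itself, so it has to be shown to be an event.
\<close>

lemma core_converges_event:
  "{\<omega> \<in> space M. \<exists>\<phi>. config_tendsto (\<lambda>t. Y t \<omega>) \<phi>} \<union>
    {\<omega> \<in> space M. config_tendsto_infinity (\<lambda>t. Y t \<omega>)} \<in> sets M"
proof -
  note [measurable] = Y_measurable centre_measurable
  have "{\<omega> \<in> space M. \<exists>\<phi>. config_tendsto (\<lambda>t. Y t \<omega>) \<phi>} =
      {\<omega> \<in> space M. (\<lambda>t. spread (Y t \<omega>)) \<longlonglongrightarrow> 0} \<inter> {\<omega> \<in> space M. Cauchy (\<lambda>t. centre (Y t \<omega>))}"
    using config_tendsto_iff[of "\<lambda>t. Y t _" n] size_Y n_bounds(1)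
    by (auto simp: spread_def Cauchy_convergent_iff convergent_def)
  also have "\<dots> \<in> sets M"
    by (intro sets.Int tendsto_0_set_measurable sets_Collect_Cauchy) measurable
  finally have 1: "{\<omega> \<in> space M. \<exists>\<phi>. config_tendsto (\<lambda>t. Y t \<omega>) \<phi>} \<in> sets M" .
  have [measurable]: "(\<lambda>\<omega>. size {#x \<in># Y t \<omega>. x \<in> ball 0 (real k)#}) \<in> measurable M (count_space UNIV)" for t k
    by (rule measurable_compose[OF Y_measurable count_in_measurable]) simp
  have ne: "Y t \<omega> \<noteq> {#}" if "\<omega> \<in> space M" for t \<omega>
    using size_Y[OF that, of t] n_bounds(1) by auto
  have "{\<omega> \<in> space M. config_tendsto_infinity (\<lambda>t. Y t \<omega>)} =
      {\<omega> \<in> space M. \<forall>k::nat. \<exists>T. \<forall>t\<ge>T. size {#x \<in># Y t \<omega>. x \<in> ball 0 (real k)#} = 0}"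
    by (intro Collect_cong conj_cong refl config_tendsto_infinity_iff ne)
  also have "\<dots> \<in> sets M" by measurable
  finally show ?thesis using 1 by (rule sets.Un[rotated])
qed

end

theorem theorem2:
  fixes P :: "'z measure" and \<zeta> :: "'z \<Rightarrow> real ^ 'd"
    and M :: "'w measure" and N K :: nat
    and X Y :: "nat \<Rightarrow> 'w \<Rightarrow> (real ^ 'd) multiset"
    and Z :: "nat \<Rightarrow> nat \<Rightarrow> 'w \<Rightarrow> real ^ 'd"
  assumes "N \<ge> 3" and "K \<ge> 1" and "2 * K < N"
    and "prob_space P" and "\<zeta> \<in> measurable P borel"
    and "\<forall>x\<in>supp (distr P borel \<zeta>). \<exists>\<gamma>>0.
           regular (distr P borel \<zeta>) (ball x \<gamma> \<inter> supp (distr P borel \<zeta>))"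
    and "jante_process M N K (distr P borel \<zeta>) X Y Z"
  shows "measure M ({\<omega> \<in> space M. \<exists>\<phi>. config_tendsto (\<lambda>t. Y t \<omega>) \<phi>} \<union>
                    {\<omega> \<in> space M. config_tendsto_infinity (\<lambda>t. Y t \<omega>)}) = 1"
proof -
  interpret jante_dynamics M N K "distr P borel \<zeta>" X Y Z
    using assms by (simp add: jante_dynamics_def jante_dynamics_axioms_def)
  show ?thesis
    unfolding prob_eq_1[OF core_converges_event]
    using AE_core_converges[OF assms(6)] AE_space by eventually_elim auto
qed

end
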